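(* Let $H$ be a complex Hilbert space and $\Omega=\{0,1\}^{\mathbb N}$. (i) Let $E:\mathcal B(\Omega)\to B(H)_+$ be a POVM, and for each finite word $w$ in the alphabet $\{0,1\}$ put $E_w=E([w])$ and $H_w=\overline{\operatorname{ran}}(E_w^{1/2})$. Then, for every finite word $w$, there is a unique positive contraction $A_w$ on $H_w$ such that $$E_{w0}=E_w^{1/2}A_wE_w^{1/2}\qquad\text{and}\qquad E_{w1}=E_w^{1/2}(I_{H_w}-A_w)E_w^{1/2}.$$ (ii) Conversely, suppose that $E_\varnothing=I$ and that operators $E_w$, indexed by the finite words $w$ in $\{0,1\}$, are obtained recursively from positive contractions $A_w$ on $H_w=\overline{\operatorname{ran}}(E_w^{1/2})$ by $$E_{w0}=E_w^{1/2}A_wE_w^{1/2},\qquad E_{w1}=E_w^{1/2}(I_{H_w}-A_w)E_w^{1/2}$$ for every finite word $w$. Then there is a unique POVM $E:\mathcal B(\Omega)\to B(H)_+$ with $E([w])=E_w$ for every finite word $w$.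
   Context: $\Omega=\{0,1\}^{\mathbb N}$ carries its product Borel $\sigma$-algebra $\mathcal B(\Omega)$. For a finite word $w=w_1\cdots w_n$ in $\{0,1\}$, $[w]=\{x\in\Omega:x_1=w_1,\dots,x_n=w_n\}$; the empty word is $\varnothing$, and $[\varnothing]=\Omega$; $w0$ and $w1$ denote $w$ with a letter appended. $B(H)_+$ is the set of bounded positive operators on $H$. A POVM on $\Omega$ with values in $B(H)$ is a map $E:\mathcal B(\Omega)\to B(H)_+$ that is countably additive in the weak operator topology and satisfies $E(\Omega)=I$. A positive contraction on $H_w$ is $A\in B(H_w)$ with $0\le A\le I_{H_w}$. In products such as $E_w^{1/2}AE_w^{1/2}$, an operator $A$ on $H_w$ is extended by zero on $H_w^\perp$. *)

theory Defs
  imports "HOL-Analysis.Analysis" "HOL-Library.Nonpos_Ints"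
begin

section \<open>Complex Hilbert spaces\<close>

class complex_vector = real_vector +
  fixes scaleC :: "complex \<Rightarrow> 'a \<Rightarrow> 'a"  (infixr "*\<^sub>C" 75)
  assumes scaleC_add_right: "c *\<^sub>C (x + y) = c *\<^sub>C x + c *\<^sub>C y"
    and scaleC_add_left: "(c + d) *\<^sub>C x = c *\<^sub>C x + d *\<^sub>C x"
    and scaleC_scaleC: "c *\<^sub>C d *\<^sub>C x = (c * d) *\<^sub>C x"
    and scaleR_scaleC: "r *\<^sub>R x = complex_of_real r *\<^sub>C x"

text \<open>The inner product is linear in its first argument. Definiteness follows from
  \<open>norm_eq_sqrt_cinner\<close> and the norm axioms.\<close>

class complex_inner = complex_vector + real_normed_vector +
  fixes cinner :: "'a \<Rightarrow> 'a \<Rightarrow> complex"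
  assumes cinner_commute: "cinner x y = cnj (cinner y x)"
    and cinner_add_left: "cinner (x + y) z = cinner x z + cinner y z"
    and cinner_scaleC_left: "cinner (c *\<^sub>C x) y = c * cinner x y"
    and cinner_ge_zero: "0 \<le> Re (cinner x x)"
    and norm_eq_sqrt_cinner: "norm x = sqrt (Re (cinner x x))"

class chilbert_space = complex_inner + complete_space

instantiation complex :: chilbert_space
begin

definition scaleC_complex :: "complex \<Rightarrow> complex \<Rightarrow> complex"
  where "scaleC_complex c x = c * x"

definition cinner_complex :: "complex \<Rightarrow> complex \<Rightarrow> complex"
  where "cinner_complex x y = x * cnj y"

instance
  by standard
    (simp_all add: scaleC_complex_def cinner_complex_def algebra_simps scaleR_conv_of_real
      cmod_def power2_eq_square)

end


section \<open>Operators on closed subspaces\<close>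

text \<open>For a closed subspace \<open>S\<close>, \<open>bounded_ops S\<close> is \<open>B(S)\<close>. Elements are functions with domain
  \<open>S\<close>, i.e. extensional (equal to \<open>undefined\<close> off \<open>S\<close>), so that equality of functions is equality
  of operators on \<open>S\<close>. With \<open>S = UNIV\<close> this is \<open>B(H)\<close>.\<close>

definition bounded_ops :: "'a::complex_inner set \<Rightarrow> ('a \<Rightarrow> 'a) set"
  where "bounded_ops S = {T \<in> S \<rightarrow>\<^sub>E S.
    (\<forall>x\<in>S. \<forall>y\<in>S. T (x + y) = T x + T y) \<and>
    (\<forall>c. \<forall>x\<in>S. T (c *\<^sub>C x) = c *\<^sub>C T x) \<and>
    (\<exists>K. \<forall>x\<in>S. norm (T x) \<le> K * norm x)}"

lemma bounded_ops_UNIV: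
  "T \<in> bounded_ops UNIV \<longleftrightarrow> bounded_linear T \<and> (\<forall>c x. T (c *\<^sub>C x) = c *\<^sub>C T x)"
proof
  assume "T \<in> bounded_ops UNIV"
  then obtain K where "\<And>x y. T (x + y) = T x + T y" and s: "\<And>c x. T (c *\<^sub>C x) = c *\<^sub>C T x"
    and "\<And>x. norm (T x) \<le> K * norm x"
    by (auto simp: bounded_ops_def)
  then have "bounded_linear T"
    by (intro bounded_linear_intro[where K = K]) (simp_all add: scaleR_scaleC mult.commute)
  with s show "bounded_linear T \<and> (\<forall>c x. T (c *\<^sub>C x) = c *\<^sub>C T x)" by blast
next
  assume T: "bounded_linear T \<and> (\<forall>c x. T (c *\<^sub>C x) = c *\<^sub>C T x)"
  then interpret bounded_linear T by blast
  from bounded T show "T \<in> bounded_ops UNIV"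
    by (auto simp: bounded_ops_def add mult.commute)
qed

definition positive_ops :: "'a::complex_inner set \<Rightarrow> ('a \<Rightarrow> 'a) set"
  where "positive_ops S = {T \<in> bounded_ops S. \<forall>x\<in>S. cinner (T x) x \<in> \<real>\<^sub>\<ge>\<^sub>0}"

definition id_minus :: "'a::complex_inner set \<Rightarrow> ('a \<Rightarrow> 'a) \<Rightarrow> 'a \<Rightarrow> 'a"
  where "id_minus S A = (\<lambda>x\<in>S. x - A x)"

definition positive_contraction :: "'a::complex_inner set \<Rightarrow> ('a \<Rightarrow> 'a) \<Rightarrow> bool"
  where "positive_contraction S A \<longleftrightarrow> A \<in> positive_ops S \<and> id_minus S A \<in> positive_ops S"

definition orth_proj :: "'a::complex_inner set \<Rightarrow> 'a \<Rightarrow> 'a"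
  where "orth_proj S x = (THE p. p \<in> S \<and> (\<forall>s\<in>S. cinner (x - p) s = 0))"

text \<open>The operator on \<open>H\<close> that agrees with \<open>A\<close> on \<open>S\<close> and vanishes on the orthogonal complement
  of \<open>S\<close>.\<close>

definition extend_by_zero :: "'a::complex_inner set \<Rightarrow> ('a \<Rightarrow> 'a) \<Rightarrow> 'a \<Rightarrow> 'a"
  where "extend_by_zero S A = (\<lambda>x. A (orth_proj S x))"

definition op_sqrt :: "('a::complex_inner \<Rightarrow> 'a) \<Rightarrow> 'a \<Rightarrow> 'a"
  where "op_sqrt T = (THE R. R \<in> positive_ops UNIV \<and> R \<circ> R = T)"

definition sqrt_range_closure :: "('a::complex_inner \<Rightarrow> 'a) \<Rightarrow> 'a set"
  where "sqrt_range_closure T = closure (range (op_sqrt T))"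

text \<open>\<open>T\<^sup>1\<^sup>/\<^sup>2 A T\<^sup>1\<^sup>/\<^sup>2\<close> for an operator \<open>A\<close> on the closure of the range of \<open>T\<^sup>1\<^sup>/\<^sup>2\<close>.\<close>

definition sqrt_sandwich :: "('a::complex_inner \<Rightarrow> 'a) \<Rightarrow> ('a \<Rightarrow> 'a) \<Rightarrow> 'a \<Rightarrow> 'a"
  where "sqrt_sandwich T A = op_sqrt T \<circ> extend_by_zero (sqrt_range_closure T) A \<circ> op_sqrt T"


section \<open>Operator-valued measures on Cantor space\<close>

text \<open>Cantor space is \<^typ>\<open>nat \<Rightarrow> bool\<close> with \<open>False\<close>, \<open>True\<close> for the letters 0, 1 and coordinates
  numbered from 0; \<^term>\<open>borel :: (nat \<Rightarrow> bool) measure\<close> refers to the product topology.\<close>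

definition cylinder :: "bool list \<Rightarrow> (nat \<Rightarrow> bool) set"
  where "cylinder w = {x. \<forall>i<length w. x i = w ! i}"

text \<open>Only the measurable space underlying \<open>M\<close> is used. A POVM has domain \<open>sets M\<close>, i.e. it is
  extensional there. Countable additivity is in the weak operator topology: the partial sums converge
  in every matrix coefficient.\<close>

definition povm :: "'b measure \<Rightarrow> ('b set \<Rightarrow> 'a::chilbert_space \<Rightarrow> 'a) \<Rightarrow> bool"
  where "povm M E \<longleftrightarrow>
    E \<in> sets M \<rightarrow>\<^sub>E positive_ops UNIV \<and>
    (\<forall>F :: nat \<Rightarrow> 'b set. range F \<subseteq> sets M \<longrightarrow> disjoint_family F \<longrightarrow>
      (\<forall>x y. (\<lambda>n. cinner (E (F n) x) y) sums cinner (E (\<Union>n. F n) x) y)) \<and>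
    E (space M) = id"

end

theory Submission
  imports Defs
begin

text \<open>
  \<^bold>\<open>Square roots.\<close> The operators \<open>E\<^sub>w\<close> satisfy \<open>0 \<le> T \<le> I\<close>; such a \<open>T\<close> is called an effect. With
  \<open>X = I - T\<close> the Taylor series of \<open>sqrt (1 - z)\<close> at \<open>X\<close> converges absolutely, because its
  coefficients are absolutely summable. Its sum is positive and squares to \<open>T\<close>, and it commutes with
  every operator that commutes with \<open>T\<close>, whence uniqueness (\<open>effect_sqrt_ex1\<close>).

  \<^bold>\<open>From the measure to the contractions.\<close> A POVM is finitely additive, so \<open>T = E [w]\<close> and \<open>F = E [w0]\<close>
  satisfy \<open>0 \<le> F \<le> T\<close> and \<open>E [w1] = T - F\<close>. It remains to factor \<open>F = T\<^sup>1\<^sup>/\<^sup>2 A T\<^sup>1\<^sup>/\<^sup>2\<close> with a unique positive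
  contraction \<open>A\<close> on the closed range of \<open>T\<^sup>1\<^sup>/\<^sup>2\<close>; the second equation then holds automatically. This
  is Douglas's lemma (\<open>sandwich_factorization\<close>). It rests on a form of the Riesz representation
  theorem for functionals dominated by \<open>x \<mapsto> \<parallel>T\<^sup>1\<^sup>/\<^sup>2 x\<parallel>\<close> (\<open>dominated_functional_representation\<close>).

  \<^bold>\<open>From the contractions to the measure.\<close> The recursion keeps every \<open>E\<^sub>w\<close> an effect and gives
  \<open>E\<^sub>w = E\<^sub>w\<^sub>0 + E\<^sub>w\<^sub>1\<close>. For each vector \<open>x\<close> the additive mass function \<open>w \<mapsto> \<langle>E\<^sub>w x, x\<rangle>\<close> comes from a finite
  Borel measure \<open>\<mu>\<^sub>x\<close> on Cantor space, obtained by pushing Lebesgue measure on an interval forward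
  along nested subdivisions (\<open>cantor_measure_exists\<close>). The Borel sets \<open>B\<close> for which some effect has
  the quadratic form \<open>x \<mapsto> \<mu>\<^sub>x B\<close> contain the cylinders and are closed under complements and, by
  strong convergence of bounded series of positive operators (\<open>effect_series\<close>), under countable
  disjoint unions. So they are all Borel sets by Dynkin's theorem. This defines the POVM, its weak
  countable additivity being inherited from the \<open>\<mu>\<^sub>x\<close> by polarization; Dynkin's theorem also gives its
  uniqueness.
\<close>

section \<open>Inner products and positive operators\<close>

instance chilbert_space \<subseteq> banach ..

lemma scaleC_zero_left [simp]: "0 *\<^sub>C (x::'a::complex_vector) = 0"
  using scaleR_scaleC[of 0 x] by simp

lemma scaleC_minus_one: "(-1) *\<^sub>C (x::'a::complex_vector) = - x"
  using scaleR_scaleC[of "-1" x] by simp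

lemma scaleC_zero_right [simp]: "c *\<^sub>C (0::'a::complex_vector) = 0"
  using scaleC_scaleC[of c 0 "0::'a"] by simp

lemma scaleC_diff_right: "c *\<^sub>C ((x::'a::complex_vector) - y) = c *\<^sub>C x - c *\<^sub>C y"
  using scaleC_add_right[of c "x - y" y] by (simp add: algebra_simps)

lemma scaleC_scaleR_commute: "c *\<^sub>C r *\<^sub>R (x::'a::complex_vector) = r *\<^sub>R c *\<^sub>C x"
  by (simp add: scaleR_scaleC scaleC_scaleC mult.commute)

context
  fixes x y z :: "'a::complex_inner"
begin

lemma cinner_add_right: "cinner x (y + z) = cinner x y + cinner x z"
  using cinner_commute[of x "y + z"] cinner_commute[of x y] cinner_commute[of x z]
  by (simp add: cinner_add_left)

lemma cinner_scaleC_right: "cinner x (c *\<^sub>C y) = cnj c * cinner x y"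
  using cinner_commute[of x "c *\<^sub>C y"] cinner_commute[of x y]
  by (simp add: cinner_scaleC_left)

lemma cinner_zero_left [simp]: "cinner 0 x = 0"
  using cinner_scaleC_left[of 0 x x] by simp

lemma cinner_minus_left: "cinner (- x) y = - cinner x y"
  using cinner_scaleC_left[of "-1" x y] by (simp add: scaleC_minus_one)

lemma cinner_minus_right: "cinner x (- y) = - cinner x y"
  using cinner_commute[of x "- y"] cinner_commute[of x y] cinner_scaleC_left[of "-1" y x]
  by (simp add: scaleC_minus_one)

lemma cinner_scaleR_left: "cinner (r *\<^sub>R x) y = of_real r * cinner x y"
  by (simp add: scaleR_scaleC cinner_scaleC_left)

end

lemma cinner_diff_left: "cinner (x - y) (z::'a::complex_inner) = cinner x z - cinner y z"
  using cinner_add_left[of x "- y" z] by (simp add: cinner_minus_left)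

lemma cinner_diff_right: "cinner (z::'a::complex_inner) (x - y) = cinner z x - cinner z y"
  using cinner_add_right[of z x "- y"] by (simp add: cinner_minus_right)

lemma cinner_scaleR_right: "cinner y (r *\<^sub>R (x::'a::complex_inner)) = of_real r * cinner y x"
  by (simp add: scaleR_scaleC cinner_scaleC_right)

lemma cinner_self: "cinner x x = of_real ((norm (x::'a::complex_inner))\<^sup>2)"
proof -
  have "Im (cinner x x) = 0"
    using arg_cong[OF cinner_commute[of x x], of Im] by simp
  moreover have "Re (cinner x x) = (norm x)\<^sup>2"
    by (simp add: norm_eq_sqrt_cinner cinner_ge_zero)
  ultimately show ?thesis by (simp add: complex_eq_iff)
qed

lemma cinner_eq_zero_imp: "(\<And>y. cinner x y = 0) \<Longrightarrow> (x::'a::complex_inner) = 0"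
  using cinner_self[of x] by auto

lemma norm_add_sq:
  "(norm (x + y))\<^sup>2 = (norm x)\<^sup>2 + 2 * Re (cinner x y) + (norm (y::'a::complex_inner))\<^sup>2"
proof -
  have "Re (cinner (x + y) (x + y)) = (norm x)\<^sup>2 + 2 * Re (cinner x y) + (norm y)\<^sup>2"
    using arg_cong[OF cinner_commute[of y x], of Re]
    unfolding cinner_add_left cinner_add_right by (simp add: cinner_self)
  then show ?thesis by (simp add: cinner_self)
qed

lemma parallelogram:
  "(norm (x + y))\<^sup>2 + (norm (x - y))\<^sup>2 = 2 * (norm x)\<^sup>2 + 2 * (norm (y::'a::complex_inner))\<^sup>2"
  using norm_add_sq[of x y] norm_add_sq[of x "- y"] by (simp add: cinner_minus_right)

lemma norm_scaleC: "norm (c *\<^sub>C (x::'a::complex_inner)) = cmod c * norm x"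
proof -
  have "cinner (c *\<^sub>C x) (c *\<^sub>C x) = of_real ((cmod c * norm x)\<^sup>2)"
    unfolding cinner_scaleC_left cinner_scaleC_right cinner_self[of x] power_mult_distrib
      of_real_mult complex_norm_square by simp
  then have "(norm (c *\<^sub>C x))\<^sup>2 = (cmod c * norm x)\<^sup>2"
    unfolding cinner_self of_real_eq_iff .
  then show ?thesis by simp
qed

lemma bounded_linear_scaleC: "bounded_linear (\<lambda>x::'a::complex_inner. c *\<^sub>C x)"
  by (rule bounded_linear_intro[where K = "cmod c"])
    (simp_all add: scaleC_add_right scaleC_scaleR_commute norm_scaleC mult.commute)

text \<open>The Cauchy--Schwarz inequality for semidefinite forms, so that it applies to
  \<open>(x, y) \<mapsto> \<langle>T x, y\<rangle>\<close> for every positive \<open>T\<close>.\<close>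

lemma Cauchy_Schwarz_form:
  fixes B :: "'a::complex_vector \<Rightarrow> 'a \<Rightarrow> complex"
  assumes add: "\<And>x y z. B (x + y) z = B x z + B y z"
    and scale: "\<And>c x y. B (c *\<^sub>C x) y = c * B x y"
    and herm: "\<And>x y. B x y = cnj (B y x)"
    and nonneg: "\<And>x. 0 \<le> Re (B x x)"
  shows "(cmod (B x y))\<^sup>2 \<le> Re (B x x) * Re (B y y)"
proof -
  \<comment> \<open>Expand the form at \<open>x - t c y\<close> and choose the real number \<open>t\<close>.\<close>
  define a b c where "a = Re (B x x)" and "b = Re (B y y)" and "c = B x y"
  have add': "B z (x + y) = B z x + B z y" for x y z
    using herm[of z "x + y"] herm[of z x] herm[of z y] by (simp add: add)
  have scale': "B y (r *\<^sub>C x) = cnj r * B y x" for r x y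
    using herm[of y "r *\<^sub>C x"] herm[of y x] by (simp add: scale)
  have yy: "B y y = of_real b"
    using arg_cong[OF herm[of y y], of Im] by (simp add: b_def complex_eq_iff)
  have yx: "B y x = cnj c" using herm[of y x] by (simp add: c_def)
  have key: "0 \<le> a - 2 * t * (cmod c)\<^sup>2 + t\<^sup>2 * (cmod c)\<^sup>2 * b" for t :: real
  proof -
    define s where "s = - of_real t * c"
    have "B (x + s *\<^sub>C y) (x + s *\<^sub>C y) = B x x + cnj s * c + s * cnj c + s * cnj s * of_real b"
      by (simp add: add add' scale scale' yy yx c_def[symmetric] algebra_simps)
    also have "\<dots> = B x x - 2 * of_real t * (c * cnj c) + (of_real t)\<^sup>2 * (c * cnj c) * of_real b"
      by (simp add: s_def algebra_simps power2_eq_square)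
    also have "\<dots> = B x x + of_real (- 2 * t * (cmod c)\<^sup>2 + t\<^sup>2 * (cmod c)\<^sup>2 * b)"
      unfolding complex_norm_square[symmetric] by simp
    finally show ?thesis using nonneg[of "x + s *\<^sub>C y"] by (simp add: a_def)
  qed
  have "(cmod c)\<^sup>2 \<le> a * b"
  proof (cases "b = 0")
    case True
    have "c = 0"
    proof (rule ccontr)
      assume "c \<noteq> 0"
      with key[of "(a + 1) / (2 * (cmod c)\<^sup>2)"] True show False by (simp add: field_simps)
    qed
    with True show ?thesis by simp
  next
    case False
    with nonneg[of y] have "b > 0" by (simp add: b_def)
    with key[of "1 / b"] show ?thesis by (simp add: field_simps power2_eq_square)
  qed
  then show ?thesis by (simp add: a_def b_def c_def)
qed

lemma Cauchy_Schwarz: "cmod (cinner x y) \<le> norm x * norm (y::'a::complex_inner)"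
proof -
  have "(cmod (cinner x y))\<^sup>2 \<le> Re (cinner x x) * Re (cinner y y)"
    by (rule Cauchy_Schwarz_form)
      (simp_all add: cinner_add_left cinner_scaleC_left cinner_ge_zero flip: cinner_commute)
  also have "\<dots> = (norm x * norm y)\<^sup>2" by (simp add: cinner_self power_mult_distrib)
  finally show ?thesis by (rule power2_le_imp_le) simp
qed

lemma bounded_linear_cinner_left: "bounded_linear (\<lambda>x. cinner x (y::'a::complex_inner))"
  by (rule bounded_linear_intro[where K = "norm y"])
    (simp_all add: cinner_add_left cinner_scaleR_left scaleR_conv_of_real Cauchy_Schwarz)

lemma tendsto_cinner:
  assumes f: "(f \<longlongrightarrow> a) F" and g: "(g \<longlongrightarrow> (b::'a::complex_inner)) F"
  shows "((\<lambda>n. cinner (f n) (g n)) \<longlongrightarrow> cinner a b) F"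
proof -
  have b: "bounded_bilinear (cinner :: 'a \<Rightarrow> 'a \<Rightarrow> complex)"
    by (rule bounded_bilinear.intro)
      (auto simp: cinner_add_left cinner_add_right cinner_scaleR_left cinner_scaleR_right
        scaleR_conv_of_real intro!: exI[of _ 1] Cauchy_Schwarz)
  show ?thesis by (rule bounded_bilinear.tendsto[OF b f g])
qed

subsection \<open>Positive operators on the whole space\<close>

lemma positive_ops_UNIV_iff:
  "T \<in> positive_ops UNIV \<longleftrightarrow> bounded_linear T \<and> (\<forall>c x. T (c *\<^sub>C x) = c *\<^sub>C T x) \<and>
    (\<forall>x. 0 \<le> Re (cinner (T x) x) \<and> Im (cinner (T x) x) = 0)"
  by (auto simp: positive_ops_def bounded_ops_UNIV complex_nonneg_Reals_iff)

lemma polarization: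
  fixes T :: "'a::complex_inner \<Rightarrow> 'a"
  assumes add: "\<And>x y. T (x + y) = T x + T y" and scale: "\<And>c x. T (c *\<^sub>C x) = c *\<^sub>C T x"
  shows "cinner (T x) y = (cinner (T (x + y)) (x + y) - cinner (T (x - y)) (x - y)
    + \<i> * cinner (T (x + \<i> *\<^sub>C y)) (x + \<i> *\<^sub>C y)
    - \<i> * cinner (T (x - \<i> *\<^sub>C y)) (x - \<i> *\<^sub>C y)) / 4"
proof -
  have diff: "T (x - y) = T x - T y" for x y
    using add[of "x - y" y] by (simp add: algebra_simps)
  show ?thesis
    by (simp add: add diff scale cinner_add_left cinner_add_right cinner_diff_left
        cinner_diff_right cinner_scaleC_left cinner_scaleC_right algebra_simps)
qed

context
  fixes T :: "'a::complex_inner \<Rightarrow> 'a"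
  assumes T: "T \<in> positive_ops UNIV"
begin

lemma pos_bounded_linear: "bounded_linear T"
  using T by (simp add: positive_ops_UNIV_iff)

lemma pos_add: "T (x + y) = T x + T y"
  using pos_bounded_linear by (simp add: linear_simps)

lemma pos_diff: "T (x - y) = T x - T y"
  using pos_bounded_linear by (simp add: linear_simps)

lemma pos_scaleC: "T (c *\<^sub>C x) = c *\<^sub>C T x"
  using T by (simp add: positive_ops_UNIV_iff)

lemma pos_Re: "0 \<le> Re (cinner (T x) x)"
  using T by (simp add: positive_ops_UNIV_iff)

lemma pos_quadratic_real: "cinner (T x) x = of_real (Re (cinner (T x) x))"
  using T by (simp add: positive_ops_UNIV_iff complex_eq_iff)

text \<open>Real quadratic forms force self-adjointness: expand them at \<open>x + y\<close> and at \<open>x + \<i> y\<close>.\<close>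

lemma pos_self_adjoint: "cinner (T x) y = cinner x (T y)"
proof -
  have im: "Im (cinner (T z) z) = 0" for z
    using T by (simp add: positive_ops_UNIV_iff)
  have "Im (cinner (T x) y) + Im (cinner (T y) x) = 0"
    using im[of "x + y"] im[of x] im[of y]
    by (simp add: pos_add cinner_add_left cinner_add_right)
  moreover have "Re (cinner (T y) x) = Re (cinner (T x) y)"
    using im[of "x + \<i> *\<^sub>C y"] im[of x] im[of y]
    by (simp add: pos_add pos_scaleC cinner_add_left cinner_add_right cinner_scaleC_left
        cinner_scaleC_right)
  ultimately have "cinner (T x) y = cnj (cinner (T y) x)" by (simp add: complex_eq_iff)
  then show ?thesis by (simp flip: cinner_commute)
qed

lemma pos_Cauchy_Schwarz:
  "(cmod (cinner (T x) y))\<^sup>2 \<le> Re (cinner (T x) x) * Re (cinner (T y) y)"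
proof (rule Cauchy_Schwarz_form)
  show "cinner (T x) y = cnj (cinner (T y) x)" for x y
    using pos_self_adjoint cinner_commute by metis
qed (simp_all add: pos_add pos_scaleC cinner_add_left cinner_scaleC_left pos_Re)

lemma pos_zero_if_quadratic_zero:
  assumes "Re (cinner (T x) x) = 0" shows "T x = 0"
  using pos_Cauchy_Schwarz[of x "T x"] assms by (simp add: cinner_self)

end

lemma positive_op_eqI_quadratic:
  assumes S: "S \<in> positive_ops UNIV" and T: "T \<in> positive_ops UNIV"
    and eq: "\<And>x. Re (cinner (S x) x) = Re (cinner (T x) x)"
  shows "S = T"
proof
  fix x
  have q: "cinner (S x) x = cinner (T x) x" for x
    using pos_quadratic_real[OF S] pos_quadratic_real[OF T] eq by metis
  have "cinner (S x) y = cinner (T x) y" for y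
    by (simp only: polarization[OF pos_add[OF S] pos_scaleC[OF S], of x y]
        polarization[OF pos_add[OF T] pos_scaleC[OF T], of x y] q)
  then have "cinner (S x - T x) y = 0" for y by (simp add: cinner_diff_left)
  then have "S x - T x = 0" by (rule cinner_eq_zero_imp)
  then show "S x = T x" by simp
qed

text \<open>An \<^emph>\<open>effect\<close> is an operator \<open>T\<close> on the whole space with \<open>0 \<le> T \<le> I\<close>.\<close>

definition effect :: "('a::complex_inner \<Rightarrow> 'a) \<Rightarrow> bool"
  where "effect T \<longleftrightarrow> T \<in> positive_ops UNIV \<and> (\<forall>x. Re (cinner (T x) x) \<le> (norm x)\<^sup>2)"

lemma effect_pos: "effect T \<Longrightarrow> T \<in> positive_ops UNIV"
  by (simp add: effect_def)

lemma effect_le: "effect T \<Longrightarrow> Re (cinner (T x) x) \<le> (norm x)\<^sup>2"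
  by (simp add: effect_def)

text \<open>\<open>T\<^sup>2 \<le> T\<close> for an effect, from the Cauchy--Schwarz inequality for the form of \<open>T\<close>.\<close>

lemma effect_norm_sq:
  assumes T: "effect T" shows "(norm (T x))\<^sup>2 \<le> Re (cinner (T x) x)"
proof -
  have "((norm (T x))\<^sup>2)\<^sup>2 = (cmod (cinner (T x) (T x)))\<^sup>2" by (simp add: cinner_self norm_power)
  also have "\<dots> \<le> Re (cinner (T x) x) * Re (cinner (T (T x)) (T x))"
    by (rule pos_Cauchy_Schwarz[OF effect_pos[OF T]])
  also have "\<dots> \<le> Re (cinner (T x) x) * (norm (T x))\<^sup>2"
    by (intro mult_left_mono effect_le[OF T] pos_Re[OF effect_pos[OF T]])
  finally show ?thesis
    using pos_Re[OF effect_pos[OF T], of x] by (cases "T x = 0") (auto simp: power2_eq_square)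
qed

lemma effect_norm: assumes T: "effect T" shows "norm (T x) \<le> norm x"
  using effect_norm_sq[OF T, of x] effect_le[OF T, of x] by (auto intro: power2_le_imp_le[OF order_trans])

lemma effectI:
  assumes "\<And>x y. T (x + y) = T x + T y" and "\<And>c x. T (c *\<^sub>C x) = c *\<^sub>C T x"
    and "\<And>x. norm (T x) \<le> K * norm x"
    and "\<And>x. cinner (T x) x = of_real (q x)" and "\<And>x. 0 \<le> q x" and "\<And>x. q x \<le> (norm x)\<^sup>2"
  shows "effect T"
proof -
  have "bounded_linear T"
    using assms by (intro bounded_linear_intro[where K = K]) (simp_all add: scaleR_scaleC mult.commute)
  with assms show ?thesis by (simp add: effect_def positive_ops_UNIV_iff)
qed

lemma effect_id: "effect id"
  by (rule effectI[where K = 1 and q = "\<lambda>x. (norm x)\<^sup>2"]) (simp_all add: cinner_self)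

lemma effect_diff:
  assumes S: "effect S" and T: "T \<in> positive_ops UNIV"
    and le: "\<And>x. Re (cinner (T x) x) \<le> Re (cinner (S x) x)"
  shows "effect (\<lambda>x. S x - T x)"
proof -
  note S' = effect_pos[OF S]
  have "bounded_linear (\<lambda>x. S x - T x)"
    by (intro bounded_linear_sub pos_bounded_linear S' T)
  moreover have "Im (cinner (S x - T x) x) = 0" for x
    using pos_quadratic_real[OF S', of x] pos_quadratic_real[OF T, of x]
    by (simp add: cinner_diff_left complex_eq_iff)
  ultimately show ?thesis
    using effect_le[OF S] pos_Re[OF T] le
    by (auto simp: effect_def positive_ops_UNIV_iff cinner_diff_left pos_scaleC[OF S']
        pos_scaleC[OF T] scaleC_diff_right intro: order_trans[OF diff_left_mono[of 0]] add_increasing2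
        simp: diff_le_eq)
qed

section \<open>Representation of functionals by minimization\<close>

text \<open>If a linear functional \<open>\<psi>\<close> is dominated by a multiple of \<open>x \<mapsto> \<parallel>R x\<parallel>\<close>, then \<open>\<psi> x = \<langle>R x, z\<rangle>\<close> for some \<open>z\<close> in the
  closed range of \<open>R\<close>. For \<open>R = id\<close> this is the Riesz representation theorem; in general it is the
  core of Douglas's factorization lemma. The vector \<open>z\<close> is the limit of \<open>R x\<^sub>n\<close> along a minimizing
  sequence \<open>x\<^sub>n\<close> of \<open>J x = \<parallel>R x\<parallel>\<^sup>2 - 2 Re (\<psi> x)\<close>, which converges by the parallelogram law.\<close>

lemma dominated_functional_representation:
  fixes R :: "'a::chilbert_space \<Rightarrow> 'a" and \<psi> :: "'a \<Rightarrow> complex"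
  assumes R: "R \<in> positive_ops UNIV"
    and add: "\<And>x y. \<psi> (x + y) = \<psi> x + \<psi> y" and scale: "\<And>c x. \<psi> (c *\<^sub>C x) = c * \<psi> x"
    and dom: "\<And>x. cmod (\<psi> x) \<le> K * norm (R x)" and K: "0 \<le> K"
  obtains z where "z \<in> closure (range R)" "\<And>x. cinner (R x) z = \<psi> x" "norm z \<le> K"
proof -
  define J where "J x = (norm (R x))\<^sup>2 - 2 * Re (\<psi> x)" for x
  have scaleR: "\<psi> (r *\<^sub>R x) = of_real r * \<psi> x" for r x by (simp add: scaleR_scaleC scale)
  have RscaleR: "R (r *\<^sub>R x) = r *\<^sub>R R x" for r x by (simp add: scaleR_scaleC pos_scaleC[OF R])
  have lower: "- (K\<^sup>2) \<le> J x" for x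
  proof -
    have "Re (\<psi> x) \<le> K * norm (R x)" using complex_Re_le_cmod dom order_trans by blast
    moreover have "0 \<le> (norm (R x) - K)\<^sup>2" by simp
    ultimately show ?thesis by (simp add: J_def power2_diff mult.commute)
  qed
  define m where "m = Inf (range J)"
  have bdd: "bdd_below (range J)" using lower by (intro bdd_belowI) auto
  have m_le: "m \<le> J x" for x unfolding m_def by (rule cInf_lower[OF _ bdd]) simp
  have "\<exists>x. J x < m + 1 / real (Suc n)" for n
    using cInf_lessD[of "range J" "m + 1 / real (Suc n)"] by (auto simp: m_def)
  then obtain X where X: "\<And>n. J (X n) < m + 1 / real (Suc n)" by metis
  \<comment> \<open>Compare \<open>J\<close> at \<open>u\<close>, \<open>v\<close> and their midpoint.\<close>
  have gap: "(norm (R u - R v))\<^sup>2 \<le> 2 * (J u - m) + 2 * (J v - m)" for u v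
  proof -
    have "J ((1/2) *\<^sub>R (u + v)) = (norm (R u + R v))\<^sup>2 / 4 - Re (\<psi> u) - Re (\<psi> v)"
      by (simp add: J_def RscaleR scaleR pos_add[OF R] add power_divide add_divide_distrib
          del: scaleR_add_right)
    with m_le[of "(1/2) *\<^sub>R (u + v)"] parallelogram[of "R u" "R v"]
    show ?thesis by (simp add: J_def field_simps)
  qed
  have "Cauchy (\<lambda>n. R (X n))"
  proof (rule metric_CauchyI)
    fix e :: real assume "e > 0"
    then obtain N :: nat where N: "4 / e\<^sup>2 < real N" using reals_Archimedean2 by blast
    with \<open>e > 0\<close> have Np: "0 < real N" by (smt (verit) zero_less_divide_iff zero_less_power)
    have small: "J (X n) - m < e\<^sup>2 / 4" if "n \<ge> N" for n
    proof -
      have "1 / real (Suc n) \<le> 1 / real N" using that Np by (intro divide_left_mono) auto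
      also have "\<dots> < e\<^sup>2 / 4" using N Np \<open>e > 0\<close> by (simp add: field_simps)
      finally show ?thesis using X[of n] by simp
    qed
    have "dist (R (X p)) (R (X q)) < e" if "p \<ge> N" "q \<ge> N" for p q
    proof -
      have "(norm (R (X p) - R (X q)))\<^sup>2 < e\<^sup>2"
        using gap[of "X p" "X q"] small[OF that(1)] small[OF that(2)] by simp
      then show ?thesis unfolding dist_norm using \<open>e > 0\<close> by (simp add: power2_less_imp_less)
    qed
    then show "\<exists>N. \<forall>p\<ge>N. \<forall>q\<ge>N. dist (R (X p)) (R (X q)) < e" by blast
  qed
  then obtain z where z: "(\<lambda>n. R (X n)) \<longlonglongrightarrow> z" using Cauchy_convergent convergent_def by blast
  \<comment> \<open>The first variation of \<open>J\<close> vanishes at the minimizer.\<close>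
  have Re_eq: "Re (cinner (R x) z) = Re (\<psi> x)" for x
  proof -
    define \<beta> where "\<beta> = Re (cinner (R x) z) - Re (\<psi> x)"
    have var: "0 \<le> 2 * t * \<beta> + t\<^sup>2 * (norm (R x))\<^sup>2" for t :: real
    proof (rule LIMSEQ_le_const)
      have "(\<lambda>n. 1 / real (Suc n) + 2 * t * (Re (cinner (R x) (R (X n))) - Re (\<psi> x))
          + t\<^sup>2 * (norm (R x))\<^sup>2) \<longlonglongrightarrow> 0 + 2 * t * \<beta> + t\<^sup>2 * (norm (R x))\<^sup>2"
        unfolding \<beta>_def
        by (intro tendsto_intros tendsto_cinner z LIMSEQ_Suc[OF lim_1_over_n])
      then show "(\<lambda>n. 1 / real (Suc n) + 2 * t * (Re (cinner (R x) (R (X n))) - Re (\<psi> x))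
          + t\<^sup>2 * (norm (R x))\<^sup>2) \<longlonglongrightarrow> 2 * t * \<beta> + t\<^sup>2 * (norm (R x))\<^sup>2" by simp
      have "0 \<le> 1 / real (Suc n) + 2 * t * (Re (cinner (R x) (R (X n))) - Re (\<psi> x))
          + t\<^sup>2 * (norm (R x))\<^sup>2" for n
      proof -
        have "Re (cinner (R (X n)) (R x)) = Re (cinner (R x) (R (X n)))"
          using arg_cong[OF cinner_commute[of "R (X n)" "R x"], of Re] by simp
        then have "J (X n + t *\<^sub>R x) = J (X n)
            + (2 * t * (Re (cinner (R x) (R (X n))) - Re (\<psi> x)) + t\<^sup>2 * (norm (R x))\<^sup>2)"
          by (simp add: J_def pos_add[OF R] RscaleR add scaleR norm_add_sq cinner_scaleR_right
              power_mult_distrib algebra_simps)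
        with m_le[of "X n + t *\<^sub>R x"] X[of n] show ?thesis by linarith
      qed
      then show "\<exists>N. \<forall>n\<ge>N. 0 \<le> 1 / real (Suc n) + 2 * t * (Re (cinner (R x) (R (X n))) - Re (\<psi> x))
          + t\<^sup>2 * (norm (R x))\<^sup>2" by blast
    qed
    have "\<beta> = 0"
    proof (cases "norm (R x) = 0")
      case True
      then show ?thesis using var[of 1] var[of "-1"] by simp
    next
      case False
      with var[of "- \<beta> / (norm (R x))\<^sup>2"] have "\<beta>\<^sup>2 \<le> 0"
        by (simp add: field_simps power2_eq_square)
      then show ?thesis by simp
    qed
    then show ?thesis by (simp add: \<beta>_def)
  qed
  have rep: "cinner (R x) z = \<psi> x" for x
  proof -
    have "Im (cinner (R x) z) = Im (\<psi> x)"
      using Re_eq[of "\<i> *\<^sub>C x"] by (simp add: pos_scaleC[OF R] cinner_scaleC_left scale)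
    with Re_eq show ?thesis by (simp add: complex_eq_iff)
  qed
  have "norm z \<le> K"
  proof -
    have "(\<lambda>n. cmod (cinner (R (X n)) z)) \<longlonglongrightarrow> cmod (cinner z z)"
      by (intro tendsto_norm tendsto_cinner z tendsto_const)
    moreover have "(\<lambda>n. K * norm (R (X n))) \<longlonglongrightarrow> K * norm z"
      by (intro tendsto_intros z)
    ultimately have "cmod (cinner z z) \<le> K * norm z"
      by (rule LIMSEQ_le) (simp add: rep dom)
    then show ?thesis using K
      by (cases "norm z = 0") (auto simp: cinner_self norm_mult power2_eq_square)
  qed
  moreover have "z \<in> closure (range R)"
    unfolding closure_sequential using z by (auto intro!: exI[of _ "\<lambda>n. R (X n)"])
  ultimately show thesis using that rep by blast
qed

section \<open>Square roots of effects\<close>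

text \<open>The Taylor coefficients of \<open>sqrt (1 - z)\<close>.\<close>

definition sqrt_coeff :: "nat \<Rightarrow> real"
  where "sqrt_coeff n = pochhammer (-1/2) n / fact n"

lemma sqrt_coeff_0 [simp]: "sqrt_coeff 0 = 1"
  by (simp add: sqrt_coeff_def)

lemma sqrt_coeff_nonpos: "n > 0 \<Longrightarrow> sqrt_coeff n \<le> 0"
proof (cases n)
  case (Suc k)
  have "0 < pochhammer (1/2::real) k" by (rule pochhammer_pos) simp
  then show ?thesis by (simp add: Suc sqrt_coeff_def pochhammer_rec field_simps)
qed simp

lemma sqrt_coeff_sum: "(\<Sum>k\<le>n. sqrt_coeff k) = pochhammer (1/2) n / fact n"
proof (induction n)
  case (Suc n)
  have "(\<Sum>k\<le>Suc n. sqrt_coeff k) =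
      pochhammer (1/2) n / fact n - (1/2) * pochhammer (1/2) n / ((1 + real n) * fact n)"
    using Suc by (simp add: sqrt_coeff_def pochhammer_rec)
  also have "\<dots> = (1/2 + real n) * pochhammer (1/2) n / ((1 + real n) * fact n)"
    by (simp add: divide_simps) (simp add: algebra_simps)
  finally show ?case by (simp add: pochhammer_rec')
qed simp

text \<open>All coefficients but the first are nonpositive, so nonnegative partial sums bound the sum of
  their absolute values, and below they also give positivity of the operator series.\<close>

lemma sqrt_coeff_sum_nonneg: "0 \<le> (\<Sum>k\<le>n. sqrt_coeff k)"
  unfolding sqrt_coeff_sum by (intro divide_nonneg_pos less_imp_le pochhammer_pos) simp_all

lemma summable_abs_sqrt_coeff: "summable (\<lambda>n. \<bar>sqrt_coeff n\<bar>)"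
proof (rule bounded_imp_summable[where B = 2])
  fix n
  have "(\<Sum>k\<le>n. \<bar>sqrt_coeff k\<bar>) = (\<Sum>k\<le>n. (if k = 0 then 2 else 0) - sqrt_coeff k)"
    by (intro sum.cong refl) (auto simp: sqrt_coeff_nonpos)
  also have "\<dots> \<le> 2" using sqrt_coeff_sum_nonneg[of n] by (simp add: sum_subtractf)
  finally show "(\<Sum>k\<le>n. \<bar>sqrt_coeff k\<bar>) \<le> 2" .
qed simp

text \<open>The coefficients of the square of the Taylor series are those of \<open>1 - z\<close>.\<close>

lemma sqrt_coeff_convolution:
  "(\<Sum>i\<le>n. sqrt_coeff i * sqrt_coeff (n - i)) = (if n = 0 then 1 else if n = 1 then - 1 else 0)"
proof -
  have "(\<Sum>i\<le>n. sqrt_coeff i * sqrt_coeff (n - i)) =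
      (\<Sum>i\<le>n. of_nat (n choose i) * pochhammer (-1/2) i * pochhammer (-1/2) (n - i)) / fact n"
    unfolding sum_divide_distrib
    by (intro sum.cong refl) (simp add: sqrt_coeff_def binomial_fact)
  also have "\<dots> = pochhammer (-1/2 + -1/2) n / fact n"
    by (simp only: pochhammer_binomial_sum)
  also have "pochhammer (-1/2 + -1/2) n = (if n = 0 then 1 else if n = 1 then - 1 else (0::real))"
  proof (cases n)
    case (Suc k)
    then show ?thesis by (cases k) (simp_all add: pochhammer_rec)
  qed simp
  finally show ?thesis by simp
qed

lemma
  assumes X: "effect X"
  shows effect_funpow_add: "(X ^^ n) (x + y) = (X ^^ n) x + (X ^^ n) y"
    and effect_funpow_scaleC: "(X ^^ n) (c *\<^sub>C x) = c *\<^sub>C (X ^^ n) x"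
    and effect_funpow_norm: "norm ((X ^^ n) x) \<le> norm x"
    and effect_funpow_adjoint: "cinner ((X ^^ n) x) y = cinner x ((X ^^ n) y)"
proof -
  note X' = effect_pos[OF X]
  show "(X ^^ n) (x + y) = (X ^^ n) x + (X ^^ n) y"
    by (induction n) (simp_all add: pos_add[OF X'])
  show "(X ^^ n) (c *\<^sub>C x) = c *\<^sub>C (X ^^ n) x"
    by (induction n) (simp_all add: pos_scaleC[OF X'])
  show "norm ((X ^^ n) x) \<le> norm x"
    by (induction n) (auto intro: order_trans[OF effect_norm[OF X]])
  show "cinner ((X ^^ n) x) y = cinner x ((X ^^ n) y)"
  proof (induction n arbitrary: y)
    case (Suc n)
    have "cinner ((X ^^ Suc n) x) y = cinner ((X ^^ n) x) (X y)"
      by (simp add: pos_self_adjoint[OF X'])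
    with Suc show ?case by (simp add: funpow_swap1)
  qed simp
qed

text \<open>\<open>sqrt (I - X)\<close> for an effect \<open>X\<close>, as an absolutely convergent power series.\<close>

definition sqrt_series :: "('a::chilbert_space \<Rightarrow> 'a) \<Rightarrow> 'a \<Rightarrow> 'a"
  where "sqrt_series X x = (\<Sum>n. sqrt_coeff n *\<^sub>R (X ^^ n) x)"

context
  fixes X :: "'a::chilbert_space \<Rightarrow> 'a"
  assumes X: "effect X"
begin

lemma summable_norm_sqrt_series: "summable (\<lambda>n. norm (sqrt_coeff n *\<^sub>R (X ^^ n) x))"
proof (rule summable_comparison_test')
  show "summable (\<lambda>n. \<bar>sqrt_coeff n\<bar> * norm x)"
    by (rule summable_mult2[OF summable_abs_sqrt_coeff])
  show "norm (norm (sqrt_coeff n *\<^sub>R (X ^^ n) x)) \<le> \<bar>sqrt_coeff n\<bar> * norm x" if "n \<ge> 0" for n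
    using effect_funpow_norm[OF X] by (simp add: mult_left_mono)
qed

lemma sqrt_series_sums: "(\<lambda>n. sqrt_coeff n *\<^sub>R (X ^^ n) x) sums sqrt_series X x"
  unfolding sqrt_series_def
  by (intro summable_sums summable_norm_cancel[OF summable_norm_sqrt_series])

lemma sqrt_series_has_sum: "((\<lambda>n. sqrt_coeff n *\<^sub>R (X ^^ n) x) has_sum sqrt_series X x) UNIV"
  by (rule norm_summable_imp_has_sum[OF summable_norm_sqrt_series sqrt_series_sums])

lemma sqrt_series_commute:
  assumes Q: "bounded_linear Q" and comm: "\<And>x. Q (X x) = X (Q x)"
  shows "Q (sqrt_series X x) = sqrt_series X (Q x)"
proof -
  have *: "Q ((X ^^ n) x) = (X ^^ n) (Q x)" for n
    by (induction n) (simp_all add: comm)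
  have "(\<lambda>n. Q (sqrt_coeff n *\<^sub>R (X ^^ n) x)) sums Q (sqrt_series X x)"
    by (rule bounded_linear.sums[OF Q sqrt_series_sums])
  then have "(\<lambda>n. sqrt_coeff n *\<^sub>R (X ^^ n) (Q x)) sums Q (sqrt_series X x)"
    by (simp add: linear_cmul[OF bounded_linear.linear[OF Q]] *)
  with sqrt_series_sums[of "Q x"] show ?thesis using sums_unique2 by blast
qed

lemma sqrt_series_pos: "sqrt_series X \<in> positive_ops UNIV"
proof -
  have add: "sqrt_series X (x + y) = sqrt_series X x + sqrt_series X y" for x y
    using sums_add[OF sqrt_series_sums[of x] sqrt_series_sums[of y]] sqrt_series_sums[of "x + y"]
    by (simp add: effect_funpow_add[OF X] scaleR_add_right sums_unique2)
  have scale: "sqrt_series X (c *\<^sub>C x) = c *\<^sub>C sqrt_series X x" for c x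
    using bounded_linear.sums[OF bounded_linear_scaleC sqrt_series_sums, of c x]
      sqrt_series_sums[of "c *\<^sub>C x"]
    by (simp add: effect_funpow_scaleC[OF X] scaleC_scaleR_commute sums_unique2)
  have bound: "norm (sqrt_series X x) \<le> (\<Sum>n. \<bar>sqrt_coeff n\<bar>) * norm x" for x
  proof -
    have "norm (sqrt_series X x) \<le> (\<Sum>n. norm (sqrt_coeff n *\<^sub>R (X ^^ n) x))"
      unfolding sqrt_series_def by (rule summable_norm[OF summable_norm_sqrt_series])
    also have "\<dots> \<le> (\<Sum>n. \<bar>sqrt_coeff n\<bar> * norm x)"
      by (intro suminf_le summable_norm_sqrt_series summable_mult2[OF summable_abs_sqrt_coeff])
        (simp add: effect_funpow_norm[OF X] mult_left_mono)
    also have "\<dots> = (\<Sum>n. \<bar>sqrt_coeff n\<bar>) * norm x"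
      by (rule suminf_mult2[OF summable_abs_sqrt_coeff, symmetric])
    finally show ?thesis .
  qed
  have "bounded_linear (sqrt_series X)"
    by (rule bounded_linear_intro[where K = "\<Sum>n. \<bar>sqrt_coeff n\<bar>"])
      (simp_all add: add scale scaleR_scaleC bound mult.commute[of "norm _"])
  moreover have "0 \<le> Re (cinner (sqrt_series X x) x) \<and> Im (cinner (sqrt_series X x) x) = 0" for x
  proof
    have real: "Im (cinner ((X ^^ n) x) x) = 0" for n
      using arg_cong[OF cinner_commute[of "(X ^^ n) x" x], of Im] effect_funpow_adjoint[OF X]
      by simp
    have le: "Re (cinner ((X ^^ n) x) x) \<le> (norm x)\<^sup>2" for n
    proof -
      have "Re (cinner ((X ^^ n) x) x) \<le> norm ((X ^^ n) x) * norm x"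
        by (rule order_trans[OF complex_Re_le_cmod Cauchy_Schwarz])
      also have "\<dots> \<le> norm x * norm x"
        by (intro mult_right_mono effect_funpow_norm[OF X]) simp
      finally show ?thesis by (simp add: power2_eq_square)
    qed
    have sums: "(\<lambda>n. of_real (sqrt_coeff n) * cinner ((X ^^ n) x) x) sums cinner (sqrt_series X x) x"
      using bounded_linear.sums[OF bounded_linear_cinner_left sqrt_series_sums]
      by (simp add: cinner_scaleR_left)
    show "Im (cinner (sqrt_series X x) x) = 0"
      using sums_Im[OF sums] by (simp add: real sums_0 sums_unique2[OF _ sums_zero])
    have "(\<lambda>n. \<Sum>k\<le>n. sqrt_coeff k * Re (cinner ((X ^^ k) x) x)) \<longlonglongrightarrow> Re (cinner (sqrt_series X x) x)"
      using sums_Re[OF sums] by (simp add: sums_def_le)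
    moreover have "0 \<le> (\<Sum>k\<le>n. sqrt_coeff k * Re (cinner ((X ^^ k) x) x))" for n
    proof -
      have "0 \<le> (\<Sum>k\<le>n. sqrt_coeff k) * (norm x)\<^sup>2"
        by (intro mult_nonneg_nonneg sqrt_coeff_sum_nonneg) simp
      also have "\<dots> \<le> (\<Sum>k\<le>n. sqrt_coeff k * Re (cinner ((X ^^ k) x) x))"
        unfolding sum_distrib_right
      proof (rule sum_mono)
        fix k
        show "sqrt_coeff k * (norm x)\<^sup>2 \<le> sqrt_coeff k * Re (cinner ((X ^^ k) x) x)"
        proof (cases "k = 0")
          case False
          then show ?thesis using le sqrt_coeff_nonpos by (intro mult_left_mono_neg) auto
        qed (simp add: cinner_self)
      qed
      finally show ?thesis .
    qed
    ultimately show "0 \<le> Re (cinner (sqrt_series X x) x)"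
      by (intro LIMSEQ_le_const) auto
  qed
  ultimately show ?thesis by (simp add: positive_ops_UNIV_iff scale)
qed

text \<open>The square of the series is rearranged along the antidiagonals, as in the Cauchy product.\<close>

lemma sqrt_series_square: "sqrt_series X (sqrt_series X x) = x - X x"
proof -
  define g where "g = (\<lambda>(i, j). (sqrt_coeff i * sqrt_coeff j) *\<^sub>R (X ^^ (i + j)) x)"
  have abs: "(\<lambda>n. \<bar>sqrt_coeff n\<bar>) summable_on UNIV"
    using norm_summable_imp_summable_on[of "\<lambda>n. \<bar>sqrt_coeff n\<bar>"] summable_abs_sqrt_coeff by simp
  have "(\<lambda>z. norm (case z of (i, j) \<Rightarrow> \<bar>sqrt_coeff i\<bar> * (\<bar>sqrt_coeff j\<bar> * norm x)))
      summable_on UNIV \<times> UNIV"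
    unfolding Infinite_Sum.abs_summable_on_Sigma_iff
    by (auto simp: abs_mult infsum_cmult_right'
        intro!: summable_on_cmult_right summable_on_cmult_left abs)
  then have "(\<lambda>z. norm (g z)) summable_on UNIV \<times> UNIV"
    by (rule Infinite_Sum.abs_summable_on_comparison_test)
      (auto simp: g_def abs_mult mult.assoc intro!: mult_left_mono effect_funpow_norm[OF X])
  then have g: "(g has_sum infsum g (UNIV \<times> UNIV)) (UNIV \<times> UNIV)"
    by (rule has_sum_infsum[OF Infinite_Sum.abs_summable_summable])
  have inner: "((\<lambda>j. g (i, j)) has_sum sqrt_coeff i *\<^sub>R (X ^^ i) (sqrt_series X x)) UNIV" for i
  proof -
    have "bounded_linear (X ^^ i)"
      by (rule bounded_linear_intro[where K = 1])
        (simp_all add: effect_funpow_add[OF X] effect_funpow_scaleC[OF X] scaleR_scaleC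
          effect_funpow_norm[OF X])
    from has_sum_scaleR[OF has_sum_bounded_linear[OF this sqrt_series_has_sum]]
    show ?thesis
      by (simp add: g_def scaleR_scaleC effect_funpow_scaleC[OF X] scaleC_scaleC funpow_add)
  qed
  have 1: "sqrt_series X (sqrt_series X x) = infsum g (UNIV \<times> UNIV)"
    using has_sum_SigmaD[OF g inner] sqrt_series_has_sum has_sum_unique by blast
  have "((\<lambda>(n, i). g (i, n - i)) has_sum infsum g (UNIV \<times> UNIV)) (Sigma UNIV (\<lambda>n. {..n}))"
    by (rule iffD2[OF has_sum_reindex_bij_witness[where i = "\<lambda>(i, j). (i + j, i)"
            and j = "\<lambda>(n, i). (i, n - i)"] g]) auto
  moreover have "((\<lambda>i. case (n, i) of (n, i) \<Rightarrow> g (i, n - i)) has_sum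
      (\<Sum>i\<le>n. sqrt_coeff i * sqrt_coeff (n - i)) *\<^sub>R (X ^^ n) x) {..n}" for n
  proof -
    have "(\<Sum>i\<le>n. g (i, n - i)) = (\<Sum>i\<le>n. sqrt_coeff i * sqrt_coeff (n - i)) *\<^sub>R (X ^^ n) x"
      by (simp add: g_def scaleR_sum_left)
    then show ?thesis using has_sum_finite[of "{..n}" "\<lambda>i. g (i, n - i)"] by simp
  qed
  ultimately have "((\<lambda>n. (\<Sum>i\<le>n. sqrt_coeff i * sqrt_coeff (n - i)) *\<^sub>R (X ^^ n) x) has_sum
      infsum g (UNIV \<times> UNIV)) UNIV"
    by (rule has_sum_SigmaD)
  then have "(\<lambda>n. (\<Sum>i\<le>n. sqrt_coeff i * sqrt_coeff (n - i)) *\<^sub>R (X ^^ n) x) sums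
      infsum g (UNIV \<times> UNIV)"
    by (rule has_sum_imp_sums)
  moreover have "(\<lambda>n. (\<Sum>i\<le>n. sqrt_coeff i * sqrt_coeff (n - i)) *\<^sub>R (X ^^ n) x) sums
      (\<Sum>n\<in>{0, 1}. (\<Sum>i\<le>n. sqrt_coeff i * sqrt_coeff (n - i)) *\<^sub>R (X ^^ n) x)"
    by (rule sums_finite) (auto simp: sqrt_coeff_convolution)
  ultimately have "infsum g (UNIV \<times> UNIV) = x - X x"
    using sums_unique2 by (fastforce simp: sqrt_coeff_convolution)
  then show ?thesis unfolding 1 .
qed

end

lemma effect_sqrt_ex1:
  fixes T :: "'a::chilbert_space \<Rightarrow> 'a"
  assumes T: "effect T"
  shows "\<exists>!R. R \<in> positive_ops UNIV \<and> R \<circ> R = T"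
proof -
  note T' = effect_pos[OF T]
  define X where "X = (\<lambda>x. x - T x)"
  have X: "effect X"
    using effect_diff[OF effect_id T'] effect_le[OF T] by (simp add: X_def cinner_self)
  define R where "R = sqrt_series X"
  have R: "R \<in> positive_ops UNIV" unfolding R_def by (rule sqrt_series_pos[OF X])
  have RR: "R (R x) = T x" for x unfolding R_def sqrt_series_square[OF X] by (simp add: X_def)
  show ?thesis
  proof (rule ex1I[of _ R])
    show "R \<in> positive_ops UNIV \<and> R \<circ> R = T" using R RR by auto
    fix Q assume "Q \<in> positive_ops UNIV \<and> Q \<circ> Q = T"
    then have Q: "Q \<in> positive_ops UNIV" and QQ: "\<And>x. Q (Q x) = T x" by auto
    have "Q (X x) = X (Q x)" for x
      by (simp add: X_def pos_diff[OF Q] flip: QQ)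
    then have comm: "Q (R x) = R (Q x)" for x
      unfolding R_def by (intro sqrt_series_commute[OF X] pos_bounded_linear Q)
    show "Q = R"
    proof
      fix x
      \<comment> \<open>As \<open>(R + Q) (R - Q) = 0\<close>, both forms vanish at \<open>y = (R - Q) x\<close>, so \<open>R y = 0 = Q y\<close>.\<close>
      define y where "y = R x - Q x"
      have "R y + Q y = 0"
        by (simp add: y_def pos_diff[OF R] pos_diff[OF Q] RR QQ comm)
      then have "Re (cinner (R y) y) + Re (cinner (Q y) y) = 0"
        by (metis cinner_add_left cinner_zero_left plus_complex.sel(1) zero_complex.sel(1))
      with pos_Re[OF R, of y] pos_Re[OF Q, of y]
      have "R y = 0" "Q y = 0"
        by (auto intro!: pos_zero_if_quadratic_zero[OF R] pos_zero_if_quadratic_zero[OF Q])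
      then have "cinner y y = 0"
        using pos_self_adjoint[OF R, of x y] pos_self_adjoint[OF Q, of x y]
        by (subst (1) y_def) (simp add: cinner_diff_left)
      then show "Q x = R x" by (simp add: cinner_self y_def)
    qed
  qed
qed

lemma
  fixes T :: "'a::chilbert_space \<Rightarrow> 'a"
  assumes "effect T"
  shows op_sqrt_pos: "op_sqrt T \<in> positive_ops UNIV"
    and op_sqrt_square: "op_sqrt T (op_sqrt T x) = T x"
  using theI'[OF effect_sqrt_ex1[OF assms]] by (auto simp: op_sqrt_def fun_eq_iff)

section \<open>Splitting an effect\<close>

context
  fixes R :: "'a::complex_inner \<Rightarrow> 'a"
  assumes R: "R \<in> positive_ops UNIV"
begin

lemma closure_range_add: "x \<in> closure (range R) \<Longrightarrow> y \<in> closure (range R) \<Longrightarrow> x + y \<in> closure (range R)"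
  unfolding closure_sequential
proof (elim exE conjE)
  fix f g assume *: "\<forall>n. f n \<in> range R" "f \<longlonglongrightarrow> x" "\<forall>n. g n \<in> range R" "g \<longlonglongrightarrow> y"
  have "\<exists>z. f n + g n = R z" for n
    using *(1,3) by (metis rangeE pos_add[OF R])
  then show "\<exists>h. (\<forall>n. h n \<in> range R) \<and> h \<longlonglongrightarrow> x + y"
    using tendsto_add[OF *(2,4)] by (intro exI[of _ "\<lambda>n. f n + g n"]) auto
qed

lemma closure_range_scaleC: "x \<in> closure (range R) \<Longrightarrow> c *\<^sub>C x \<in> closure (range R)"
  unfolding closure_sequential
proof (elim exE conjE)
  fix f assume *: "\<forall>n. f n \<in> range R" "f \<longlonglongrightarrow> x"
  have "\<exists>z. c *\<^sub>C f n = R z" for n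
    using *(1) by (metis rangeE pos_scaleC[OF R])
  then show "\<exists>h. (\<forall>n. h n \<in> range R) \<and> h \<longlonglongrightarrow> c *\<^sub>C x"
    using bounded_linear.tendsto[OF bounded_linear_scaleC *(2), of c]
    by (intro exI[of _ "\<lambda>n. c *\<^sub>C f n"]) auto
qed

lemma closure_range_diff: "x \<in> closure (range R) \<Longrightarrow> y \<in> closure (range R) \<Longrightarrow> x - y \<in> closure (range R)"
  using closure_range_add[of x "(-1) *\<^sub>C y"] closure_range_scaleC[of y "-1"]
  by (simp add: scaleC_minus_one)

lemma range_in_closure: "R x \<in> closure (range R)"
  by (rule subsetD[OF closure_subset]) simp

lemma closure_range_orthogonal:
  assumes z: "z \<in> closure (range R)" and orth: "\<And>x. cinner (R x) z = 0"
  shows "z = 0"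
proof -
  obtain f where f: "\<And>n. f n \<in> range R" "f \<longlonglongrightarrow> z"
    using z unfolding closure_sequential by blast
  have "cinner (f n) z = 0" for n using f(1)[of n] orth by auto
  moreover have "(\<lambda>n. cinner (f n) z) \<longlonglongrightarrow> cinner z z"
    by (intro tendsto_cinner f tendsto_const)
  ultimately have "cinner z z = 0" by (simp add: LIMSEQ_const_iff)
  then show ?thesis by (simp add: cinner_self)
qed

lemma closure_range_eqI:
  assumes "y \<in> closure (range R)" "z \<in> closure (range R)"
    and "\<And>x. cinner (R x) y = cinner (R x) z"
  shows "y = z"
  using closure_range_orthogonal[of "y - z"] closure_range_diff assms
  by (simp add: cinner_diff_right)

text \<open>In \<open>T\<^sup>1\<^sup>/\<^sup>2 A T\<^sup>1\<^sup>/\<^sup>2\<close> only vectors in the range of \<open>T\<^sup>1\<^sup>/\<^sup>2\<close> are projected, so this is all that is needed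
  about the projection.\<close>

lemma orth_proj_range: "orth_proj (closure (range R)) (R x) = R x"
  unfolding orth_proj_def
proof (rule the_equality)
  show "R x \<in> closure (range R) \<and> (\<forall>s\<in>closure (range R). cinner (R x - R x) s = 0)"
    by (simp add: range_in_closure)
  fix p assume p: "p \<in> closure (range R) \<and> (\<forall>s\<in>closure (range R). cinner (R x - p) s = 0)"
  then have "cinner (R x - p) (R x - p) = 0"
    using closure_range_diff range_in_closure by blast
  then show "p = R x" by (simp add: cinner_self)
qed

lemma bounded_ops_tendsto:
  assumes A: "A \<in> bounded_ops (closure (range R))"
    and f: "\<And>n. f n \<in> closure (range R)" "f \<longlonglongrightarrow> u" and u: "u \<in> closure (range R)"
  shows "(\<lambda>n. A (f n)) \<longlonglongrightarrow> A u"
proof -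
  obtain K where K: "\<And>x. x \<in> closure (range R) \<Longrightarrow> norm (A x) \<le> K * norm x"
    using A unfolding bounded_ops_def by blast
  have diff: "A (f n) - A u = A (f n - u)" for n
  proof -
    have "A ((f n - u) + u) = A (f n - u) + A u"
      using A closure_range_diff[OF f(1) u] u unfolding bounded_ops_def by blast
    then show ?thesis by simp
  qed
  have "(\<lambda>n. A (f n) - A u) \<longlonglongrightarrow> 0"
  proof (rule Lim_null_comparison)
    show "\<forall>\<^sub>F n in sequentially. norm (A (f n) - A u) \<le> K * norm (f n - u)"
      unfolding diff using K closure_range_diff f(1) u by simp
    show "(\<lambda>n. K * norm (f n - u)) \<longlonglongrightarrow> 0"
      using tendsto_mult_right_zero[OF tendsto_norm_zero[OF LIM_zero[OF f(2)]]] .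
  qed
  then show ?thesis by (rule LIM_zero_cancel)
qed

lemma positive_ops_closureI:
  assumes A: "A \<in> bounded_ops (closure (range R))"
    and pos: "\<And>x. cinner (A (R x)) (R x) \<in> \<real>\<^sub>\<ge>\<^sub>0"
  shows "A \<in> positive_ops (closure (range R))"
proof -
  have "cinner (A u) u \<in> \<real>\<^sub>\<ge>\<^sub>0" if u: "u \<in> closure (range R)" for u
  proof -
    obtain f where f: "\<And>n. f n \<in> range R" "f \<longlonglongrightarrow> u"
      using u unfolding closure_sequential by blast
    have "(\<lambda>n. cinner (A (f n)) (f n)) \<longlonglongrightarrow> cinner (A u) u"
      using f u closure_subset by (intro tendsto_cinner bounded_ops_tendsto[OF A]) auto
    moreover have "cinner (A (f n)) (f n) \<in> \<real>\<^sub>\<ge>\<^sub>0" for n using f(1)[of n] pos by auto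
    ultimately show ?thesis by (rule closed_sequentially[OF closed_nonneg_Reals_complex, rotated])
  qed
  with A show ?thesis by (simp add: positive_ops_def)
qed

end

context
  fixes T :: "'a::chilbert_space \<Rightarrow> 'a"
  assumes T: "effect T"
begin

lemma sandwich_apply: "sqrt_sandwich T A x = op_sqrt T (A (op_sqrt T x))"
  by (simp add: sqrt_sandwich_def extend_by_zero_def sqrt_range_closure_def
      orth_proj_range[OF op_sqrt_pos[OF T]])

lemma sandwich_cinner: "cinner (sqrt_sandwich T A x) y = cinner (A (op_sqrt T x)) (op_sqrt T y)"
  by (simp add: sandwich_apply pos_self_adjoint[OF op_sqrt_pos[OF T]])

lemma op_sqrt_in_closure: "op_sqrt T x \<in> sqrt_range_closure T"
  unfolding sqrt_range_closure_def by (rule range_in_closure[OF op_sqrt_pos[OF T]])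

lemma sandwich_id_minus:
  "sqrt_sandwich T (id_minus (sqrt_range_closure T) A) x = T x - sqrt_sandwich T A x"
  by (simp add: sandwich_apply id_minus_def op_sqrt_in_closure pos_diff[OF op_sqrt_pos[OF T]]
      op_sqrt_square[OF T])

lemma sandwich_pos:
  assumes A: "A \<in> positive_ops (sqrt_range_closure T)"
  shows "sqrt_sandwich T A \<in> positive_ops UNIV"
proof -
  note R = op_sqrt_pos[OF T] and S = op_sqrt_in_closure
  have add: "A (u + v) = A u + A v" if "u \<in> sqrt_range_closure T" "v \<in> sqrt_range_closure T" for u v
    using A that by (auto simp: positive_ops_def bounded_ops_def)
  have scale: "A (c *\<^sub>C u) = c *\<^sub>C A u" and nn: "cinner (A u) u \<in> \<real>\<^sub>\<ge>\<^sub>0"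
    if "u \<in> sqrt_range_closure T" for u c
    using A that by (auto simp: positive_ops_def bounded_ops_def)
  obtain K where K: "\<And>u. u \<in> sqrt_range_closure T \<Longrightarrow> norm (A u) \<le> K * norm u"
    using A unfolding positive_ops_def bounded_ops_def by blast
  have "bounded_linear (\<lambda>x. A (op_sqrt T x))"
  proof -
    obtain L where L: "\<And>x. norm (op_sqrt T x) \<le> norm x * L" 
      using bounded_linear.bounded[OF pos_bounded_linear[OF R]] by blast
    have "norm (A (op_sqrt T x)) \<le> norm x * (\<bar>K\<bar> * L)" for x
    proof -
      have "norm (A (op_sqrt T x)) \<le> \<bar>K\<bar> * norm (op_sqrt T x)"
        using K[OF S, of x] by (meson abs_ge_self mult_right_mono norm_ge_zero order_trans)
      also have "\<dots> \<le> \<bar>K\<bar> * (norm x * L)" by (intro mult_left_mono L) simp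
      finally show ?thesis by (simp add: mult_ac)
    qed
    then show ?thesis
      by (intro bounded_linear_intro)
        (simp_all add: pos_add[OF R] add S scale pos_scaleC[OF R] scaleR_scaleC)
  qed
  then have "bounded_linear (\<lambda>x. op_sqrt T (A (op_sqrt T x)))"
    by (rule bounded_linear_compose[OF pos_bounded_linear[OF R]])
  moreover have "sqrt_sandwich T A = (\<lambda>x. op_sqrt T (A (op_sqrt T x)))"
    by (rule ext) (rule sandwich_apply)
  moreover have "cinner (sqrt_sandwich T A x) x \<in> \<real>\<^sub>\<ge>\<^sub>0" for x
    unfolding sandwich_cinner by (rule nn[OF S])
  ultimately show ?thesis
    by (simp add: positive_ops_UNIV_iff complex_nonneg_Reals_iff pos_scaleC[OF R] scale[OF S])
qed

text \<open>The factorization \<open>F = T\<^sup>1\<^sup>/\<^sup>2 A T\<^sup>1\<^sup>/\<^sup>2\<close> of an operator \<open>0 \<le> F \<le> T\<close>. Write \<open>R = T\<^sup>1\<^sup>/\<^sup>2\<close>. As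
  \<open>|\<langle>F x, y\<rangle>| \<le> \<parallel>R x\<parallel> \<parallel>R y\<parallel>\<close>, the representation of functionals dominated by \<open>R\<close> applies twice: it
  gives \<open>D\<close> with \<open>\<langle>R x, D y\<rangle> = \<langle>x, F y\<rangle>\<close>, and then \<open>A\<close> with \<open>\<langle>R y, A u\<rangle> = \<langle>D y, u\<rangle>\<close>.\<close>

lemma sandwich_factorization:
  assumes F: "F \<in> positive_ops UNIV"
    and le: "\<And>x. Re (cinner (F x) x) \<le> Re (cinner (T x) x)"
  shows "\<exists>!A. positive_contraction (sqrt_range_closure T) A \<and> F = sqrt_sandwich T A"
proof -
  define R where "R = op_sqrt T"
  define S where "S = sqrt_range_closure T"
  have S: "S = closure (range R)" by (simp add: S_def R_def sqrt_range_closure_def)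
  have R: "R \<in> positive_ops UNIV" unfolding R_def by (rule op_sqrt_pos[OF T])
  have RR: "R (R x) = T x" for x unfolding R_def by (rule op_sqrt_square[OF T])
  have RS: "R x \<in> S" for x unfolding S by (rule range_in_closure[OF R])
  have norm_R: "(norm (R x))\<^sup>2 = Re (cinner (T x) x)" for x
    using pos_self_adjoint[OF R, of "R x" x] by (simp add: RR cinner_self)
  have dom: "cmod (cinner x (F y)) \<le> norm (R x) * norm (R y)" for x y
  proof -
    have "(cmod (cinner x (F y)))\<^sup>2 \<le> Re (cinner (F x) x) * Re (cinner (F y) y)"
      using pos_Cauchy_Schwarz[OF F, of x y] by (simp add: pos_self_adjoint[OF F])
    also have "\<dots> \<le> Re (cinner (T x) x) * Re (cinner (T y) y)"
      by (intro mult_mono le pos_Re[OF F] pos_Re[OF effect_pos[OF T]])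
    also have "\<dots> = (norm (R x) * norm (R y))\<^sup>2" by (simp add: power_mult_distrib norm_R)
    finally show ?thesis by (rule power2_le_imp_le) simp
  qed
  have "\<exists>z. z \<in> S \<and> (\<forall>x. cinner (R x) z = cinner x (F y)) \<and> norm z \<le> norm (R y)" for y
    by (rule dominated_functional_representation[OF R, of "\<lambda>x. cinner x (F y)" "norm (R y)"])
      (auto simp: S cinner_add_left cinner_scaleC_left dom mult.commute)
  then obtain D where DS: "\<And>y. D y \<in> S" and D: "\<And>x y. cinner (R x) (D y) = cinner x (F y)"
    and norm_D: "\<And>y. norm (D y) \<le> norm (R y)" by metis
  have D_add: "D (x + y) = D x + D y" for x y
    using DS D closure_range_add[OF R]
    by (intro closure_range_eqI[OF R]) (simp_all add: S cinner_add_right pos_add[OF F])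
  have D_scale: "D (c *\<^sub>C x) = c *\<^sub>C D x" for c x
    using DS D closure_range_scaleC[OF R]
    by (intro closure_range_eqI[OF R]) (simp_all add: S cinner_scaleC_right pos_scaleC[OF F])
  have dom': "cmod (cinner (D y) u) \<le> norm u * norm (R y)" for y u
  proof -
    have "cmod (cinner (D y) u) \<le> norm (D y) * norm u" by (rule Cauchy_Schwarz)
    also have "\<dots> \<le> norm (R y) * norm u" by (intro mult_right_mono norm_D) simp
    finally show ?thesis by (simp add: mult.commute)
  qed
  have "\<exists>z. z \<in> S \<and> (\<forall>y. cinner (R y) z = cinner (D y) u) \<and> norm z \<le> norm u" for u
    by (rule dominated_functional_representation[OF R, of "\<lambda>y. cinner (D y) u" "norm u"])
      (auto simp: S D_add D_scale cinner_add_left cinner_scaleC_left dom')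
  then obtain A0 where A0S: "\<And>u. A0 u \<in> S" and A0: "\<And>y u. cinner (R y) (A0 u) = cinner (D y) u"
    and norm_A0: "\<And>u. norm (A0 u) \<le> norm u" by metis
  have A0_add: "A0 (x + y) = A0 x + A0 y" for x y
    using A0S A0 closure_range_add[OF R]
    by (intro closure_range_eqI[OF R]) (simp_all add: S cinner_add_right)
  have A0_scale: "A0 (c *\<^sub>C x) = c *\<^sub>C A0 x" for c x
    using A0S A0 closure_range_scaleC[OF R]
    by (intro closure_range_eqI[OF R]) (simp_all add: S cinner_scaleC_right)
  have A0_form: "cinner (A0 (R x)) (R y) = cinner (F x) y" for x y
  proof -
    have "cinner (A0 (R x)) (R y) = cnj (cinner (D y) (R x))"
      by (subst cinner_commute) (simp add: A0)
    also have "\<dots> = cinner (R x) (D y)" by (rule cinner_commute[symmetric])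
    finally show ?thesis by (simp add: D pos_self_adjoint[OF F])
  qed
  define A where "A = restrict A0 S"
  have A_R: "A (R x) = A0 (R x)" for x by (simp add: A_def RS)
  have S_add: "x + y \<in> S" and S_diff: "x - y \<in> S" and S_scale: "c *\<^sub>C x \<in> S"
    if "x \<in> S" "y \<in> S" for x y c
    using that closure_range_add[OF R] closure_range_diff[OF R] closure_range_scaleC[OF R]
    by (simp_all add: S)
  have A_bdd: "A \<in> bounded_ops S"
    using A0S norm_A0 S_add S_scale
    by (auto simp: bounded_ops_def A_def A0_add A0_scale intro!: exI[of _ 1])
  have "norm (x - A0 x) \<le> 2 * norm x" for x
    using norm_triangle_ineq4[of x "A0 x"] norm_A0[of x] by simp
  then have IA_bdd: "id_minus S A \<in> bounded_ops S"
    using A0S S_add S_diff S_scale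
    by (auto simp: bounded_ops_def id_minus_def A_def A0_add A0_scale scaleC_diff_right
        intro!: exI[of _ 2])
  have contr: "positive_contraction S A"
    unfolding positive_contraction_def
  proof
    show "A \<in> positive_ops S"
      unfolding S
    proof (rule positive_ops_closureI[OF R])
      show "A \<in> bounded_ops (closure (range R))" using A_bdd S by simp
      show "cinner (A (R x)) (R x) \<in> \<real>\<^sub>\<ge>\<^sub>0" for x
        using F by (simp add: A_R A0_form positive_ops_def)
    qed
    show "id_minus S A \<in> positive_ops S"
      unfolding S
    proof (rule positive_ops_closureI[OF R])
      show "id_minus (closure (range R)) A \<in> bounded_ops (closure (range R))" using IA_bdd S by simp
      fix x
      have "id_minus S A (R x) = R x - A0 (R x)" by (simp add: id_minus_def RS A_R)
      moreover have "cinner (R x - A0 (R x)) (R x) = cinner (T x) x - cinner (F x) x"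
        using pos_self_adjoint[OF R, of "R x" x] by (simp add: cinner_diff_left A0_form RR)
      ultimately show "cinner (id_minus (closure (range R)) A (R x)) (R x) \<in> \<real>\<^sub>\<ge>\<^sub>0"
        using le[of x] pos_quadratic_real[OF F, of x] pos_quadratic_real[OF effect_pos[OF T], of x]
        by (simp add: complex_nonneg_Reals_iff complex_eq_iff flip: S)
    qed
  qed
  have fact: "F = sqrt_sandwich T A"
  proof
    fix x
    have "cinner (F x - sqrt_sandwich T A x) y = 0" for y
      by (simp add: cinner_diff_left sandwich_cinner A0_form A_R flip: R_def)
    then have "F x - sqrt_sandwich T A x = 0" by (rule cinner_eq_zero_imp)
    then show "F x = sqrt_sandwich T A x" by simp
  qed
  show ?thesis
    unfolding S_def[symmetric]
  proof (rule ex1I[of _ A])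
    show "positive_contraction S A \<and> F = sqrt_sandwich T A" using contr fact by simp
    fix B assume B: "positive_contraction S B \<and> F = sqrt_sandwich T B"
    then have B_bdd: "B \<in> bounded_ops S" by (simp add: positive_contraction_def positive_ops_def)
    \<comment> \<open>\<open>A\<close> and \<open>B\<close> have the same sesquilinear form on the range of \<open>R\<close>, so they agree there, and by
      continuity on its closure; off \<open>S\<close> both are \<open>undefined\<close>.\<close>
    have eq: "B (R x) = A (R x)" for x
    proof (rule closure_range_eqI[OF R])
      show "B (R x) \<in> closure (range R)" "A (R x) \<in> closure (range R)"
        using A_bdd B_bdd RS by (auto simp: bounded_ops_def simp flip: S)
      fix y
      have "cinner (B (R x)) (R y) = cinner (A (R x)) (R y)"
        using B fact sandwich_cinner unfolding R_def by metis
      then show "cinner (R y) (B (R x)) = cinner (R y) (A (R x))"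
        using cinner_commute by metis
    qed
    show "B = A"
    proof
      fix u
      show "B u = A u"
      proof (cases "u \<in> S")
        case True
        then obtain f where f: "\<And>n. f n \<in> range R" "f \<longlonglongrightarrow> u"
          unfolding S closure_sequential by blast
        have "(\<lambda>n. C (f n)) \<longlonglongrightarrow> C u" if "C \<in> bounded_ops S" for C
          using bounded_ops_tendsto[OF R _ _ f(2)] f(1) closure_subset that True
          unfolding S by blast
        note lim = this[OF A_bdd] this[OF B_bdd]
        have "B (f n) = A (f n)" for n using f(1)[of n] eq by auto
        with lim show ?thesis using LIMSEQ_unique by fastforce
      next
        case False
        then show ?thesis using A_bdd B_bdd by (auto simp: bounded_ops_def PiE_def extensional_def)
      qed
    qed
  qed
qed

end

section \<open>Measures on Cantor space\<close>

lemma cylinder_Nil [simp]: "cylinder [] = UNIV"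
  unfolding cylinder_def by auto

lemma in_cylinder_iff: "x \<in> cylinder w \<longleftrightarrow> map x [0..<length w] = w"
proof -
  have "map x [0..<length w] = w \<longleftrightarrow> (\<forall>i<length w. map x [0..<length w] ! i = w ! i)"
    unfolding list_eq_iff_nth_eq[of "map x [0..<length w]" w] by simp
  then show ?thesis unfolding cylinder_def mem_Collect_eq by simp
qed

lemma cylinder_snoc: "cylinder (w @ [b]) = {x \<in> cylinder w. x (length w) = b}"
  by (simp add: set_eq_iff in_cylinder_iff)

lemma cylinder_split: "cylinder (w @ [False]) \<union> cylinder (w @ [True]) = cylinder w"
  "cylinder (w @ [False]) \<inter> cylinder (w @ [True]) = {}"
  by (auto simp: cylinder_snoc)

lemma cylinder_Int: "cylinder v \<inter> cylinder w \<in> {{}, cylinder v, cylinder w}"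
proof -
  have *: "cylinder v \<inter> cylinder w \<in> {{}, cylinder w}" if "length v \<le> length w" for v w :: "bool list"
  proof (cases "take (length v) w = v")
    case True
    then have "v ! i = w ! i" if "i < length v" for i
      using that by (metis nth_take)
    with that have "cylinder w \<subseteq> cylinder v"
      by (fastforce simp: cylinder_def)
    then show ?thesis by auto
  next
    case False
    have "take (length v) w = v" if "x \<in> cylinder v" "x \<in> cylinder w" for x
      using that \<open>length v \<le> length w\<close> by (auto simp: cylinder_def list_eq_iff_nth_eq)
    with False show ?thesis by auto
  qed
  show ?thesis using *[of v w] *[of w v] by (cases "length v \<le> length w") (auto simp: Int_commute)
qed

lemma Int_stable_cylinders: "Int_stable (insert {} (range cylinder))"
proof (rule Int_stableI)
  fix a b :: "(nat \<Rightarrow> bool) set"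
  assume "a \<in> insert {} (range cylinder)" "b \<in> insert {} (range cylinder)"
  then consider "a \<inter> b = {}" | v w where "a = cylinder v" "b = cylinder w" by blast
  then show "a \<inter> b \<in> insert {} (range cylinder)"
  proof cases
    case 2
    then show ?thesis using cylinder_Int[of v w] by auto
  qed simp
qed

lemma open_cylinder: "open (cylinder w)"
proof -
  have "open ((\<lambda>x. x i) -` {b})" for i and b :: bool
    by (rule open_vimage[OF open_discrete]) (rule continuous_on_product_coordinates)
  then have "open (\<Inter>i\<in>{..<length w}. (\<lambda>x. x i) -` {w ! i})"
    by (intro open_INT) auto
  also have "(\<Inter>i\<in>{..<length w}. (\<lambda>x. x i) -` {w ! i}) = cylinder w"
    by (auto simp: cylinder_def)
  finally show ?thesis .
qed

text \<open>Cylinders form a countable base of the product topology.\<close>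

lemma cylinder_base:
  assumes "open U" "x \<in> U"
  obtains w where "x \<in> cylinder w" "cylinder w \<subseteq> U"
proof -
  have "openin (product_topology (\<lambda>i::nat. euclidean :: bool topology) UNIV) U"
    using assms(1) by (simp add: open_fun_def)
  from product_topology_open_contains_basis[OF this assms(2)]
  obtain X where x: "x \<in> (\<Pi>\<^sub>E i\<in>UNIV. X i)" and fin: "finite {i. X i \<noteq> UNIV}"
    and X: "(\<Pi>\<^sub>E i\<in>UNIV. X i) \<subseteq> U"
    by auto
  obtain n where n: "\<And>i. X i \<noteq> UNIV \<Longrightarrow> i < n"
    using finite_nat_set_iff_bounded[THEN iffD1, OF fin] by auto
  have "cylinder (map x [0..<n]) \<subseteq> (\<Pi>\<^sub>E i\<in>UNIV. X i)"
  proof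
    fix y assume y: "y \<in> cylinder (map x [0..<n])"
    have "y i \<in> X i" for i
    proof (cases "i < n")
      case True
      with y have "y i = x i" by (simp add: cylinder_def)
      with x show ?thesis by auto
    next
      case False
      with n have "X i = UNIV" by blast
      then show ?thesis by simp
    qed
    then show "y \<in> (\<Pi>\<^sub>E i\<in>UNIV. X i)" by auto
  qed
  with X show thesis by (intro that[of "map x [0..<n]"]) (auto simp: in_cylinder_iff)
qed

lemma borel_cantor: "sets (borel :: (nat \<Rightarrow> bool) measure) = sigma_sets UNIV (insert {} (range cylinder))"
proof -
  have "U \<in> sigma_sets UNIV (insert {} (range cylinder))" if "open U" for U :: "(nat \<Rightarrow> bool) set"
  proof -
    have "U = (\<Union>w\<in>{w. cylinder w \<subseteq> U}. cylinder w)"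
      using cylinder_base[OF that] by blast
    also have "\<dots> \<in> sigma_sets UNIV (insert {} (range cylinder))"
      by (rule sigma_sets_UNION) (auto intro: countable_subset)
    finally show ?thesis .
  qed
  then have "sigma_sets UNIV {U :: (nat \<Rightarrow> bool) set. open U} \<subseteq>
      sigma_sets UNIV (insert {} (range cylinder))"
    by (intro sigma_sets_mono) auto
  moreover have "sigma_sets UNIV (insert {} (range cylinder)) \<subseteq>
      sigma_sets UNIV {U :: (nat \<Rightarrow> bool) set. open U}"
    by (intro sigma_sets_mono') (auto simp: open_cylinder)
  ultimately show ?thesis by (simp add: borel_def)
qed

lemma cylinder_borel [measurable]: "cylinder w \<in> sets borel"
  by (intro borel_open open_cylinder)

text \<open>Dynkin's theorem for the intersection-stable generator of cylinders.\<close>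

lemma cantor_borel_induct [consumes 1, case_names cylinder empty compl union]:
  assumes "B \<in> sets (borel :: (nat \<Rightarrow> bool) measure)"
    and "\<And>w. P (cylinder w)" and "P {}"
    and "\<And>B. B \<in> sets borel \<Longrightarrow> P B \<Longrightarrow> P (UNIV - B)"
    and "\<And>F :: nat \<Rightarrow> _. disjoint_family F \<Longrightarrow> range F \<subseteq> sets borel \<Longrightarrow> (\<And>i. P (F i)) \<Longrightarrow> P (\<Union>i. F i)"
  shows "P B"
  using Int_stable_cylinders subset_UNIV[of "insert {} (range cylinder)", folded Pow_UNIV]
    assms(1)[unfolded borel_cantor]
proof (induction rule: sigma_sets_induct_disjoint)
  case (basic A)
  then show ?case using assms(2,3) by blast
next
  case (compl A)
  then show ?case using assms(4)[of A] unfolding borel_cantor by blast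
next
  case (union F)
  then show ?case using assms(5)[of F] unfolding borel_cantor by blast
qed (rule assms(3))

text \<open>Let \<open>m\<close> be a nonnegative function on words with \<open>m w = m (w0) + m (w1)\<close>. Give the word \<open>w\<close> the cell
  \<open>[left_end m w, left_end m w + m w)\<close>, starting from \<open>[0, m [])\<close>: the cell of \<open>w0\<close> is the left part, of
  length \<open>m (w0)\<close>, of the cell of \<open>w\<close>, and the cell of \<open>w1\<close> is the rest.\<close>

definition left_end :: "(bool list \<Rightarrow> real) \<Rightarrow> bool list \<Rightarrow> real"
  where "left_end m w = (\<Sum>i<length w. if w ! i then m (take i w @ [False]) else 0)"

text \<open>For \<open>t\<close> in \<open>[0, m [])\<close>, \<open>itinerary m t n\<close> is the word of length \<open>n\<close> whose cell contains \<open>t\<close>.\<close>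

primrec itinerary :: "(bool list \<Rightarrow> real) \<Rightarrow> real \<Rightarrow> nat \<Rightarrow> bool list"
  where "itinerary m t 0 = []"
  | "itinerary m t (Suc n) = itinerary m t n @
      [left_end m (itinerary m t n) + m (itinerary m t n @ [False]) \<le> t]"

lemma left_end_Nil [simp]: "left_end m [] = 0"
  by (simp add: left_end_def)

lemma left_end_snoc: "left_end m (w @ [b]) = left_end m w + (if b then m (w @ [False]) else 0)"
proof -
  have "(\<Sum>i<length w. if (w @ [b]) ! i then m (take i (w @ [b]) @ [False]) else 0) = left_end m w"
    unfolding left_end_def by (rule sum.cong) (simp_all add: nth_append)
  then show ?thesis by (simp add: left_end_def[of m "w @ [b]"])
qed

lemma length_itinerary [simp]: "length (itinerary m t n) = n"
  by (induction n) auto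

context
  fixes m :: "bool list \<Rightarrow> real"
  assumes nonneg: "\<And>w. 0 \<le> m w" and split: "\<And>w. m w = m (w @ [False]) + m (w @ [True])"
begin

lemma cell_subset: "0 \<le> left_end m w \<and> left_end m w + m w \<le> m []"
proof (induction w rule: rev_induct)
  case (snoc b w)
  then show ?case
    using nonneg[of "w @ [False]"] nonneg[of "w @ [True]"] split[of w]
    by (cases b) (auto simp: left_end_snoc)
qed simp

lemma itinerary_eq_iff:
  assumes "0 \<le> t" "t < m []"
  shows "itinerary m t (length w) = w \<longleftrightarrow> left_end m w \<le> t \<and> t < left_end m w + m w"
proof (induction w rule: rev_induct)
  case Nil
  then show ?case using assms by simp
next
  case (snoc b w)
  then show ?case
    using nonneg[of "w @ [False]"] nonneg[of "w @ [True]"] split[of w]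
    by (cases b) (auto simp: left_end_snoc)
qed

text \<open>The function \<open>f\<close> sends \<open>t\<close> to the point of Cantor space with prefixes \<open>itinerary m t n\<close>. The
  preimage of the cylinder of \<open>w\<close> is the cell of \<open>w\<close>, so \<open>f\<close> is measurable and pushes Lebesgue
  measure on \<open>[0, m [])\<close> forward to the required measure.\<close>

lemma cantor_measure_exists:
  obtains \<mu> :: "(nat \<Rightarrow> bool) measure"
  where "sets \<mu> = sets borel" "finite_measure \<mu>" "\<And>w. measure \<mu> (cylinder w) = m w"
proof -
  define f where "f t n = last (itinerary m t (Suc n))" for t n
  have map_f: "map (f t) [0..<n] = itinerary m t n" for t n
    by (induction n) (simp_all add: f_def)
  define L where "L = restrict_space lborel {0..<m []}"
  have space_L: "space L = {0..<m []}" by (simp add: L_def space_restrict_space)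
  have vimage: "f -` cylinder w \<inter> space L = {left_end m w..<left_end m w + m w}" for w
    using cell_subset[of w] by (auto simp: space_L in_cylinder_iff map_f itinerary_eq_iff)
  have sets: "{left_end m w..<left_end m w + m w} \<in> sets L" for w
    using cell_subset[of w] by (auto simp: L_def sets_restrict_space_iff)
  have f: "f \<in> measurable L borel"
  proof -
    have "f \<in> measurable L (sigma UNIV (insert {} (range cylinder)))"
      using sets by (intro measurable_measure_of) (auto simp: vimage)
    also have "measurable L (sigma UNIV (insert {} (range cylinder))) = measurable L borel"
      by (intro measurable_cong_sets refl) (simp add: borel_cantor)
    finally show ?thesis .
  qed
  have emeasure: "emeasure (distr L borel f) (cylinder w) = ennreal (m w)" for w
  proof -
    have "emeasure (distr L borel f) (cylinder w) = emeasure L {left_end m w..<left_end m w + m w}"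
      by (simp add: emeasure_distr f vimage)
    also have "\<dots> = emeasure lborel {left_end m w..<left_end m w + m w}"
      unfolding L_def using cell_subset[of w] by (intro emeasure_restrict_space) auto
    finally show ?thesis using nonneg by simp
  qed
  show thesis
  proof
    show "sets (distr L borel f) = sets borel" by simp
    show "finite_measure (distr L borel f)"
      using emeasure[of "[]"] by (intro finite_measureI) simp
    show "measure (distr L borel f) (cylinder w) = m w" for w
      using emeasure[of w] nonneg by (simp add: measure_def)
  qed
qed

end

section \<open>Positive operator-valued measures\<close>

text \<open>A series of positive operators with bounded quadratic forms converges strongly: each finite
  block \<open>P\<close> of the series is an effect, so \<open>\<parallel>P x\<parallel>\<^sup>2 \<le> \<langle>P x, x\<rangle>\<close>.\<close>

lemma effect_series:
  fixes T :: "nat \<Rightarrow> 'a::chilbert_space \<Rightarrow> 'a"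
  assumes T: "\<And>n. T n \<in> positive_ops UNIV"
    and q: "\<And>x. (\<lambda>n. Re (cinner (T n x) x)) sums q x" and le: "\<And>x. q x \<le> (norm x)\<^sup>2"
  shows "\<exists>L. effect L \<and> (\<forall>x. Re (cinner (L x) x) = q x)"
proof -
  define P where "P I x = (\<Sum>i\<in>I. T i x)" for I x
  define L where "L x = (\<Sum>n. T n x)" for x
  have cinner_sum: "cinner (\<Sum>i\<in>I. f i) x = (\<Sum>i\<in>I. cinner (f i) x)"
    if "finite I" for I :: "nat set" and f and x :: 'a
    using that by (induction I rule: finite_induct) (simp_all add: cinner_add_left)
  have P_form: "cinner (P I x) x = of_real (\<Sum>i\<in>I. Re (cinner (T i x) x))" if "finite I" for I x
    unfolding P_def cinner_sum[OF that] of_real_sum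
    by (intro sum.cong refl pos_quadratic_real[OF T])
  have P: "effect (P I)" if I: "finite I" for I
  proof -
    have "bounded_linear (P I)"
      unfolding P_def[abs_def] by (intro bounded_linear_sum pos_bounded_linear[OF T])
    moreover have "P I (c *\<^sub>C x) = c *\<^sub>C P I x" for c x
      using I unfolding P_def
      by (induction I rule: finite_induct) (simp_all add: pos_scaleC[OF T] scaleC_add_right)
    moreover have "(\<Sum>i\<in>I. Re (cinner (T i x) x)) \<le> (norm x)\<^sup>2" for x
      using sum_le_suminf[OF sums_summable[OF q[of x]] I] pos_Re[OF T] sums_unique[OF q[of x]] le[of x]
      by fastforce
    moreover have "0 \<le> (\<Sum>i\<in>I. Re (cinner (T i x) x))" for x
      by (intro sum_nonneg pos_Re[OF T])
    ultimately show ?thesis by (simp add: effect_def positive_ops_UNIV_iff P_form[OF I])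
  qed
  \<comment> \<open>The Cauchy criterion transfers from the scalar series \<open>q x\<close>.\<close>
  have "summable (\<lambda>n. T n x)" for x
    unfolding summable_Cauchy
  proof (intro allI impI)
    fix e :: real assume "e > 0"
    then obtain N where N: "\<And>m n. m \<ge> N \<Longrightarrow> norm (\<Sum>i\<in>{m..<n}. Re (cinner (T i x) x)) < e\<^sup>2"
      using sums_summable[OF q[of x]] unfolding summable_Cauchy by (meson zero_less_power)
    have "norm (\<Sum>i\<in>{m..<n}. T i x) < e" if "m \<ge> N" for m n
    proof -
      have "(norm (P {m..<n} x))\<^sup>2 \<le> (\<Sum>i\<in>{m..<n}. Re (cinner (T i x) x))"
        using effect_norm_sq[OF P, of "{m..<n}" x] by (simp add: P_form)
      also have "\<dots> < e\<^sup>2" using N[OF that, of n] by simp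
      finally show ?thesis
        unfolding P_def using \<open>e > 0\<close> by (simp add: power2_less_imp_less)
    qed
    then show "\<exists>N. \<forall>m\<ge>N. \<forall>n. norm (\<Sum>i\<in>{m..<n}. T i x) < e" by blast
  qed
  then have L: "(\<lambda>n. T n x) sums L x" for x unfolding L_def by (rule summable_sums)
  have L_form: "cinner (L x) x = of_real (q x)" for x
  proof -
    have "(\<lambda>n. cinner (T n x) x) sums cinner (L x) x"
      by (rule bounded_linear.sums[OF bounded_linear_cinner_left L])
    moreover have "(\<lambda>n. cinner (T n x) x) = (\<lambda>n. of_real (Re (cinner (T n x) x)))"
      using pos_quadratic_real[OF T] by blast
    ultimately show ?thesis using sums_of_real[OF q[of x]] sums_unique2 by metis
  qed
  have "effect L"
  proof (rule effectI[where K = 1 and q = q])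
    fix x y c
    show "L (x + y) = L x + L y"
      using sums_add[OF L L, of x y] L[of "x + y"] by (simp add: pos_add[OF T] sums_unique2)
    show "L (c *\<^sub>C x) = c *\<^sub>C L x"
      using bounded_linear.sums[OF bounded_linear_scaleC L, of c x] L[of "c *\<^sub>C x"]
      by (simp add: pos_scaleC[OF T] sums_unique2)
    have "norm (\<Sum>i<n. T i x) \<le> norm x" for n
      using effect_norm[OF P, of "{..<n}" x] by (simp add: P_def)
    then show "norm (L x) \<le> 1 * norm x"
      using L[of x] unfolding sums_def by (intro LIMSEQ_le_const2[OF tendsto_norm]) auto
    show "0 \<le> q x" using sums_le[OF _ sums_zero q[of x]] pos_Re[OF T] by blast
  qed (simp_all add: L_form le)
  with L_form show ?thesis by auto
qed

context
  fixes M :: "'b measure" and E :: "'b set \<Rightarrow> 'a::chilbert_space \<Rightarrow> 'a"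
  assumes E: "povm M E"
begin

lemma povm_pos: "B \<in> sets M \<Longrightarrow> E B \<in> positive_ops UNIV"
  using E by (auto simp: povm_def)

lemma povm_sums:
  "range F \<subseteq> sets M \<Longrightarrow> disjoint_family F \<Longrightarrow>
    (\<lambda>n. cinner (E (F n) x) y) sums cinner (E (\<Union>n. F n) x) y"
  using E by (auto simp: povm_def)

lemma povm_space: "E (space M) x = x"
  using E by (simp add: povm_def)

lemma povm_empty: "E {} x = 0"
proof (rule cinner_eq_zero_imp)
  fix y
  have "(\<lambda>n::nat. cinner (E {} x) y) sums cinner (E {} x) y"
    using povm_sums[of "\<lambda>_. {}" x y] by (simp add: disjoint_family_on_def)
  from summable_LIMSEQ_zero[OF sums_summable[OF this]] show "cinner (E {} x) y = 0"
    by (simp add: LIMSEQ_const_iff)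
qed

lemma povm_Un:
  assumes "A \<in> sets M" "B \<in> sets M" "A \<inter> B = {}"
  shows "E (A \<union> B) x = E A x + E B x"
proof -
  have "cinner (E (A \<union> B) x - (E A x + E B x)) y = 0" for y
  proof -
    have "(\<lambda>n. cinner (E (binaryset A B n) x) y) sums cinner (E (A \<union> B) x) y"
    proof -
      have rng: "range (binaryset A B) \<subseteq> sets M" using assms by (simp add: range_binaryset_eq)
      have disj: "disjoint_family (binaryset A B)"
        using assms(3) by (auto simp: disjoint_family_on_def binaryset_def)
      show ?thesis using povm_sums[OF rng disj, of x y] unfolding UN_binaryset_eq .
    qed
    moreover have "(\<lambda>n. cinner (E (binaryset A B n) x) y) sums
        (cinner (E A x) y + cinner (E B x) y)"
      by (rule binaryset_sums) (simp add: povm_empty)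
    ultimately have "cinner (E (A \<union> B) x) y = cinner (E A x) y + cinner (E B x) y"
      by (rule sums_unique2)
    then show ?thesis by (simp add: cinner_diff_left cinner_add_left)
  qed
  then have "E (A \<union> B) x - (E A x + E B x) = 0" by (rule cinner_eq_zero_imp)
  then show ?thesis by simp
qed

lemma povm_compl: "B \<in> sets M \<Longrightarrow> E (space M - B) x = x - E B x"
  using povm_Un[of B "space M - B" x] sets.sets_into_space[of B M]
  by (simp add: povm_space Un_absorb1 eq_diff_eq add.commute)

lemma povm_effect:
  assumes "B \<in> sets M" shows "effect (E B)"
  using povm_compl[OF assms] povm_pos[OF sets.compl_sets[OF assms]] povm_pos[OF assms]
    pos_Re[of "E (space M - B)"]
  by (simp add: effect_def cinner_diff_left cinner_self)

end

lemma povm_cantor_unique: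
  assumes E: "povm (borel :: (nat \<Rightarrow> bool) measure) E" and E': "povm borel E'"
    and eq: "\<And>w. E (cylinder w) = E' (cylinder w)"
  shows "E = E'"
proof
  fix B
  show "E B = E' B"
  proof (cases "B \<in> sets borel")
    case False
    with E E' show ?thesis by (auto simp: povm_def PiE_def extensional_def)
  next
    case True
    then show ?thesis
    proof (induction B rule: cantor_borel_induct)
      case (cylinder w)
      show ?case by (rule eq)
    next
      case empty
      show ?case by (simp add: fun_eq_iff povm_empty[OF E] povm_empty[OF E'])
    next
      case (compl B)
      then show ?case
        using povm_compl[OF E compl(1)] povm_compl[OF E' compl(1)] by (simp add: fun_eq_iff)
    next
      case (union F)
      show ?case
      proof
        fix x
        have "cinner (E (\<Union>i. F i) x - E' (\<Union>i. F i) x) y = 0" for y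
          using povm_sums[OF E union(2,1), of x y] povm_sums[OF E' union(2,1), of x y] union(3)
          by (simp add: cinner_diff_left sums_unique2)
        then have "E (\<Union>i. F i) x - E' (\<Union>i. F i) x = 0" by (rule cinner_eq_zero_imp)
        then show "E (\<Union>i. F i) x = E' (\<Union>i. F i) x" by simp
      qed
    qed
  qed
qed

text \<open>For each \<open>x\<close> a measure \<open>\<mu>\<^sub>x\<close> extends \<open>w \<mapsto> \<langle>E\<^sub>w x, x\<rangle>\<close>. The proof shows by Dynkin induction that
  \<open>x \<mapsto> \<mu>\<^sub>x B\<close> is the quadratic form of an effect for every Borel set \<open>B\<close>.\<close>

lemma povm_cantor_exists:
  fixes Ew :: "bool list \<Rightarrow> 'a::chilbert_space \<Rightarrow> 'a"
  assumes Nil: "Ew [] = id" and eff: "\<And>w. effect (Ew w)"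
    and split: "\<And>w x. Ew w x = Ew (w @ [False]) x + Ew (w @ [True]) x"
  shows "\<exists>E. povm borel E \<and> (\<forall>w. E (cylinder w) = Ew w)"
proof -
  have "\<exists>\<mu> :: (nat \<Rightarrow> bool) measure. sets \<mu> = sets borel \<and> finite_measure \<mu> \<and>
      (\<forall>w. measure \<mu> (cylinder w) = Re (cinner (Ew w x) x))" for x
  proof (rule cantor_measure_exists[of "\<lambda>w. Re (cinner (Ew w x) x)"])
    show "0 \<le> Re (cinner (Ew w x) x)" for w by (rule pos_Re[OF effect_pos[OF eff]])
    show "Re (cinner (Ew w x) x) =
        Re (cinner (Ew (w @ [False]) x) x) + Re (cinner (Ew (w @ [True]) x) x)" for w
      by (subst split) (simp add: cinner_add_left)
  qed blast
  then obtain \<mu> :: "'a \<Rightarrow> (nat \<Rightarrow> bool) measure" where sets: "\<And>x. sets (\<mu> x) = sets borel"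
    and fin: "\<And>x. finite_measure (\<mu> x)"
    and cyl: "\<And>x w. measure (\<mu> x) (cylinder w) = Re (cinner (Ew w x) x)"
    by metis
  have space: "space (\<mu> x) = UNIV" for x using sets_eq_imp_space_eq[OF sets[of x]] by simp
  have total: "measure (\<mu> x) UNIV = (norm x)\<^sup>2" for x
    using cyl[of x "[]"] by (simp add: Nil cinner_self)
  have le_total: "measure (\<mu> x) B \<le> (norm x)\<^sup>2" for x B
    using finite_measure.bounded_measure[OF fin, of x B] by (simp add: space total)
  have "\<exists>T. effect T \<and> (\<forall>x. Re (cinner (T x) x) = measure (\<mu> x) B)" if "B \<in> sets borel" for B
    using that
  proof (induction B rule: cantor_borel_induct)
    case (cylinder w)
    show ?case using eff cyl by metis
  next
    case empty
    have "effect (\<lambda>_. 0 :: 'a)" by (rule effectI[where K = 0 and q = "\<lambda>_. 0"]) simp_all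
    then show ?case by (intro exI[of _ "\<lambda>_. 0"]) simp
  next
    case (compl B)
    then obtain T where T: "effect T" and q: "\<And>x. Re (cinner (T x) x) = measure (\<mu> x) B" by blast
    have "effect (\<lambda>x. id x - T x)"
      by (rule effect_diff[OF effect_id effect_pos[OF T]]) (simp add: cinner_self effect_le[OF T])
    moreover have "Re (cinner (id x - T x) x) = measure (\<mu> x) (UNIV - B)" for x
      using finite_measure.finite_measure_compl[OF fin, of B x] compl(1)
      by (simp add: sets space total cinner_diff_left cinner_self q)
    ultimately show ?case by blast
  next
    case (union F)
    then obtain T where T: "\<And>n. effect (T n)"
      and q: "\<And>n x. Re (cinner (T n x) x) = measure (\<mu> x) (F n)" by metis
    have "(\<lambda>n. Re (cinner (T n x) x)) sums measure (\<mu> x) (\<Union>n. F n)" for x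
      unfolding q using union(1,2) by (intro finite_measure.finite_measure_UNION fin) (simp_all add: sets)
    then show ?case by (rule effect_series[OF effect_pos[OF T] _ le_total])
  qed
  then obtain E0 where E0: "\<And>B. B \<in> sets borel \<Longrightarrow> effect (E0 B)"
    and q: "\<And>B x. B \<in> sets borel \<Longrightarrow> Re (cinner (E0 B x) x) = measure (\<mu> x) B" by metis
  define E where "E = restrict E0 (sets borel)"
  have E_eq: "E B = E0 B" if "B \<in> sets borel" for B using that by (simp add: E_def)
  have E_cyl: "E (cylinder w) = Ew w" for w
    unfolding E_eq[OF cylinder_borel]
    by (rule positive_op_eqI_quadratic[OF effect_pos[OF E0] effect_pos[OF eff]])
      (simp_all add: q cyl)
  have "povm borel E"
    unfolding povm_def
  proof (intro conjI allI impI)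
    show "E \<in> sets borel \<rightarrow>\<^sub>E positive_ops UNIV"
      by (auto simp: E_def effect_pos E0)
    show "E (space borel) = id" using E_cyl[of "[]"] by (simp add: Nil)
    fix F :: "nat \<Rightarrow> (nat \<Rightarrow> bool) set" and x y
    assume F: "range F \<subseteq> sets borel" and disj: "disjoint_family F"
    have Fn: "F n \<in> sets borel" for n using F by auto
    then have UF: "(\<Union>n. F n) \<in> sets borel" by auto
    have quad: "(\<lambda>n. cinner (E (F n) z) z) sums cinner (E (\<Union>n. F n) z) z" for z
    proof -
      have *: "cinner (E B z) z = of_real (measure (\<mu> z) B)" if "B \<in> sets borel" for B
        using pos_quadratic_real[OF effect_pos[OF E0[OF that]]] by (simp add: E_eq that q)
      have "(\<lambda>n. measure (\<mu> z) (F n)) sums measure (\<mu> z) (\<Union>n. F n)"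
        using F disj by (intro finite_measure.finite_measure_UNION fin) (simp_all add: sets)
      then show ?thesis unfolding *[OF Fn] *[OF UF] by (rule sums_of_real)
    qed
    \<comment> \<open>Every matrix coefficient is a combination of four quadratic ones.\<close>
    have pol: "cinner (E B x) y = (cinner (E B (x + y)) (x + y) - cinner (E B (x - y)) (x - y)
        + \<i> * cinner (E B (x + \<i> *\<^sub>C y)) (x + \<i> *\<^sub>C y)
        - \<i> * cinner (E B (x - \<i> *\<^sub>C y)) (x - \<i> *\<^sub>C y)) / 4" if "B \<in> sets borel" for B
      unfolding E_eq[OF that] using effect_pos[OF E0[OF that]]
      by (intro polarization pos_add pos_scaleC)
    show "(\<lambda>n. cinner (E (F n) x) y) sums cinner (E (\<Union>n. F n) x) y"
      unfolding pol[OF Fn] pol[OF UF]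
      by (intro sums_divide sums_diff sums_add sums_mult quad)
  qed
  with E_cyl show ?thesis by blast
qed

theorem proposition2p2:
  shows "(\<forall>E :: (nat \<Rightarrow> bool) set \<Rightarrow> 'a::chilbert_space \<Rightarrow> 'a.
      povm borel E \<longrightarrow>
      (\<forall>w. \<exists>!A. positive_contraction (sqrt_range_closure (E (cylinder w))) A \<and>
        E (cylinder (w @ [False])) = sqrt_sandwich (E (cylinder w)) A \<and>
        E (cylinder (w @ [True])) =
          sqrt_sandwich (E (cylinder w)) (id_minus (sqrt_range_closure (E (cylinder w))) A)))
    \<and>
    (\<forall>(Ew :: bool list \<Rightarrow> 'a \<Rightarrow> 'a) (A :: bool list \<Rightarrow> 'a \<Rightarrow> 'a).
      Ew [] = id \<longrightarrow>
      (\<forall>w. positive_contraction (sqrt_range_closure (Ew w)) (A w) \<and>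
        Ew (w @ [False]) = sqrt_sandwich (Ew w) (A w) \<and>
        Ew (w @ [True]) = sqrt_sandwich (Ew w) (id_minus (sqrt_range_closure (Ew w)) (A w))) \<longrightarrow>
      (\<exists>!E. povm (borel :: (nat \<Rightarrow> bool) measure) E \<and> (\<forall>w. E (cylinder w) = Ew w)))"
proof (intro conjI allI impI)
  fix E :: "(nat \<Rightarrow> bool) set \<Rightarrow> 'a \<Rightarrow> 'a" and w
  assume E: "povm borel E"
  let ?T = "E (cylinder w)" and ?F = "E (cylinder (w @ [False]))" and ?G = "E (cylinder (w @ [True]))"
  have T: "effect ?T" and F: "?F \<in> positive_ops UNIV" and G: "?G \<in> positive_ops UNIV"
    using povm_effect[OF E] povm_pos[OF E] by simp_all
  have split: "?T x = ?F x + ?G x" for x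
    using povm_Un[OF E cylinder_borel cylinder_borel cylinder_split(2), of w x]
    by (simp add: cylinder_split(1))
  have "Re (cinner (?F x) x) \<le> Re (cinner (?T x) x)" for x
    using pos_Re[OF G] by (simp add: split cinner_add_left)
  then have "\<exists>!A. positive_contraction (sqrt_range_closure ?T) A \<and> ?F = sqrt_sandwich ?T A"
    by (rule sandwich_factorization[OF T F])
  moreover have "?G = sqrt_sandwich ?T (id_minus (sqrt_range_closure ?T) A)"
    if "?F = sqrt_sandwich ?T A" for A
    using split by (simp add: fun_eq_iff sandwich_id_minus[OF T] flip: that)
  ultimately show "\<exists>!A. positive_contraction (sqrt_range_closure ?T) A \<and>
      ?F = sqrt_sandwich ?T A \<and> ?G = sqrt_sandwich ?T (id_minus (sqrt_range_closure ?T) A)"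
    by blast
next
  fix Ew A :: "bool list \<Rightarrow> 'a \<Rightarrow> 'a"
  assume Nil: "Ew [] = id"
    and rec: "\<forall>w. positive_contraction (sqrt_range_closure (Ew w)) (A w) \<and>
        Ew (w @ [False]) = sqrt_sandwich (Ew w) (A w) \<and>
        Ew (w @ [True]) = sqrt_sandwich (Ew w) (id_minus (sqrt_range_closure (Ew w)) (A w))"
  have split: "Ew w x = Ew (w @ [False]) x + Ew (w @ [True]) x" if "effect (Ew w)" for w x
    using rec sandwich_id_minus[OF that, of "A w" x] by simp
  have pos: "Ew (w @ [b]) \<in> positive_ops UNIV" if "effect (Ew w)" for w b
    using rec sandwich_pos[OF that] by (cases b) (simp_all add: positive_contraction_def)
  have eff: "effect (Ew w)" for w
  proof (induction w rule: rev_induct)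
    case Nil
    show ?case unfolding \<open>Ew [] = id\<close> by (rule effect_id)
  next
    case (snoc b w)
    have "Re (cinner (Ew (w @ [b]) x) x) \<le> Re (cinner (Ew w x) x)" for x
      using pos_Re[OF pos[OF snoc]] by (cases b) (simp_all add: split[OF snoc] cinner_add_left)
    then have "Re (cinner (Ew (w @ [b]) x) x) \<le> (norm x)\<^sup>2" for x
      using effect_le[OF snoc] order_trans by blast
    then show ?case using pos[OF snoc] by (simp add: effect_def)
  qed
  obtain E where E: "povm borel E \<and> (\<forall>w. E (cylinder w) = Ew w)"
    using povm_cantor_exists[OF Nil eff split[OF eff]] by blast
  then show "\<exists>!E. povm (borel :: (nat \<Rightarrow> bool) measure) E \<and> (\<forall>w. E (cylinder w) = Ew w)"
  proof (rule ex1I[of _ E])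
    fix E' assume "povm borel E' \<and> (\<forall>w. E' (cylinder w) = Ew w)"
    with E show "E' = E" by (intro povm_cantor_unique) auto
  qed
qed

end
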